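(* Let $R$ be a commutative ring with identity $1\neq 0$ and let $M$ be a $\mathbb{P}$-radical $R$-module. Then for each $f\in R$, the module $\mathcal{O}_{\mathrm{Spec}(M)}(D(fM))$ is isomorphic (as an $R$-module) to the localized module $M_f$. In particular, $\mathcal{O}_{\mathrm{Spec}(M)}(\mathrm{Spec}(M))\cong M$.
   Context: All rings are commutative with $1\neq 0$ and modules are unital. For a submodule $N$ of $M$, $(N:M)=\{r\in R: rM\subseteq N\}$. A proper submodule $P$ of $M$ is prime if for $a\in R$, $m\in M$, $am\in P$ implies $m\in P$ or $aM\subseteq P$; then $(P:M)$ is a prime ideal of $R$. $\mathrm{Spec}(M)$ is the set of all prime submodules of $M$. For a submodule $N\le M$, $V(N)=\{P\in\mathrm{Spec}(M):(N:M)\subseteq(P:M)\}$; the sets $V(N)$ are the closed sets of the Zariski topology on $\mathrm{Spec}(M)$. For $f\in R$, $D(fM)=\mathrm{Spec}(M)\setminus V(fM)$, equivalently $D(fM)=\{P\in\mathrm{Spec}(M): f\notin (P:M)\}$. For a submodule $N$ of $M$, the prime radical $\sqrt[p]{N}$ is the intersection of all prime submodules of $M$ containing $N$, and $\sqrt[p]{N}=M$ if there are none. $M$ is called $\mathbb{P}$-radical if $(\sqrt[p]{\mathcal{P}M}:M)=\mathcal{P}$ for every prime ideal $\mathcal{P}\supseteq\mathrm{Ann}(M)$ of $R$. $M_f$ is the localization of $M$ at $\{1,f,f^2,\dots\}$. The sheaf $\mathcal{O}_{\mathrm{Spec}(M)}$ is defined as follows: for $U\subseteq \mathrm{Spec}(M)$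 open, $\mathcal{O}_{\mathrm{Spec}(M)}(U)$ is the set of functions $s:U\to\coprod_{P\in U}M_{(P:M)}$ (where $M_{(P:M)}$ is the localization of $M$ at the prime ideal $(P:M)$) with $s(P)\in M_{(P:M)}$ for all $P\in U$, such that for every $P\in U$ there are an open neighborhood $W\subseteq U$ of $P$ and elements $m\in M$, $g\in R$ such that for every $Q\in W$ one has $g\notin (Q:M)$ and $s(Q)=\frac{m}{g}$ in $M_{(Q:M)}$. Addition and the $R$-action are pointwise, and restriction maps are restrictions of functions; this is a sheaf of $R$-modules. *)

theory Defs
  imports "HOL-Analysis.Abstract_Topology" "HOL-Algebra.Ideal" "HOL-Algebra.Module"
begin

section \<open>Module isomorphisms\<close>

definition module_hom ::
  "('r, 'x) ring_scheme \<Rightarrow> ('r, 'a, 'y) module_scheme \<Rightarrow> ('r, 'b, 'z) module_scheme \<Rightarrow> ('a \<Rightarrow> 'b) set"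
  where "module_hom R A B =
    {h \<in> carrier A \<rightarrow> carrier B.
       (\<forall>x \<in> carrier A. \<forall>y \<in> carrier A. h (x \<oplus>\<^bsub>A\<^esub> y) = h x \<oplus>\<^bsub>B\<^esub> h y) \<and>
       (\<forall>r \<in> carrier R. \<forall>x \<in> carrier A. h (r \<odot>\<^bsub>A\<^esub> x) = r \<odot>\<^bsub>B\<^esub> h x)}"

definition module_isomorphic ::
  "('r, 'x) ring_scheme \<Rightarrow> ('r, 'a, 'y) module_scheme \<Rightarrow> ('r, 'b, 'z) module_scheme \<Rightarrow> bool"
  where "module_isomorphic R A B \<longleftrightarrow>
    (\<exists>h \<in> module_hom R A B. bij_betw h (carrier A) (carrier B))"


section \<open>Prime submodules and the Zariski topology\<close>

definition colon :: "('r, 'x) ring_scheme \<Rightarrow> ('r, 'm, 'y) module_scheme \<Rightarrow> 'm set \<Rightarrow> 'r set"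
  where "colon R M N = {r \<in> carrier R. \<forall>m \<in> carrier M. r \<odot>\<^bsub>M\<^esub> m \<in> N}"

definition annihilator :: "('r, 'x) ring_scheme \<Rightarrow> ('r, 'm, 'y) module_scheme \<Rightarrow> 'r set"
  where "annihilator R M = colon R M {\<zero>\<^bsub>M\<^esub>}"

definition prime_submodule ::
  "('r, 'x) ring_scheme \<Rightarrow> ('r, 'm, 'y) module_scheme \<Rightarrow> 'm set \<Rightarrow> bool"
  where "prime_submodule R M P \<longleftrightarrow>
    submodule P R M \<and> P \<noteq> carrier M \<and>
    (\<forall>a \<in> carrier R. \<forall>m \<in> carrier M.
       a \<odot>\<^bsub>M\<^esub> m \<in> P \<longrightarrow> m \<in> P \<or> (\<forall>x \<in> carrier M. a \<odot>\<^bsub>M\<^esub> x \<in> P))"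

definition Spec :: "('r, 'x) ring_scheme \<Rightarrow> ('r, 'm, 'y) module_scheme \<Rightarrow> 'm set set"
  where "Spec R M = {P. prime_submodule R M P}"

definition V :: "('r, 'x) ring_scheme \<Rightarrow> ('r, 'm, 'y) module_scheme \<Rightarrow> 'm set \<Rightarrow> 'm set set"
  where "V R M N = {P \<in> Spec R M. colon R M N \<subseteq> colon R M P}"

definition zariski :: "('r, 'x) ring_scheme \<Rightarrow> ('r, 'm, 'y) module_scheme \<Rightarrow> 'm set topology"
  where "zariski R M = topology (\<lambda>U. \<exists>N. submodule N R M \<and> U = Spec R M - V R M N)"

definition basic_open :: "('r, 'x) ring_scheme \<Rightarrow> ('r, 'm, 'y) module_scheme \<Rightarrow> 'r \<Rightarrow> 'm set set"
  where "basic_open R M f = Spec R M - V R M {f \<odot>\<^bsub>M\<^esub> m | m. m \<in> carrier M}"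


section \<open>\<open>\<P>\<close>-radical modules\<close>

definition submodule_generated ::
  "('r, 'x) ring_scheme \<Rightarrow> ('r, 'm, 'y) module_scheme \<Rightarrow> 'm set \<Rightarrow> 'm set"
  where "submodule_generated R M X = \<Inter> {N. submodule N R M \<and> X \<subseteq> N}"

definition ideal_times ::
  "('r, 'x) ring_scheme \<Rightarrow> ('r, 'm, 'y) module_scheme \<Rightarrow> 'r set \<Rightarrow> 'm set"
  where "ideal_times R M I =
    submodule_generated R M {a \<odot>\<^bsub>M\<^esub> m | a m. a \<in> I \<and> m \<in> carrier M}"

(* The intersection with carrier M makes the radical equal to M when no prime submodule contains N. *)
definition prime_radical ::
  "('r, 'x) ring_scheme \<Rightarrow> ('r, 'm, 'y) module_scheme \<Rightarrow> 'm set \<Rightarrow> 'm set"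
  where "prime_radical R M N = carrier M \<inter> \<Inter> {P \<in> Spec R M. N \<subseteq> P}"

definition P_radical :: "('r, 'x) ring_scheme \<Rightarrow> ('r, 'm, 'y) module_scheme \<Rightarrow> bool"
  where "P_radical R M \<longleftrightarrow>
    (\<forall>p. primeideal p R \<and> annihilator R M \<subseteq> p \<longrightarrow>
         colon R M (prime_radical R M (ideal_times R M p)) = p)"


section \<open>Localization of modules\<close>

definition fraction_rel ::
  "('r, 'x) ring_scheme \<Rightarrow> ('r, 'm, 'y) module_scheme \<Rightarrow> 'r set \<Rightarrow> (('m \<times> 'r) \<times> ('m \<times> 'r)) set"
  where "fraction_rel R M S =
    {((m, s), (n, t)). m \<in> carrier M \<and> s \<in> S \<and> n \<in> carrier M \<and> t \<in> S \<and>
       (\<exists>u \<in> S. u \<odot>\<^bsub>M\<^esub> (t \<odot>\<^bsub>M\<^esub> m) = u \<odot>\<^bsub>M\<^esub> (s \<odot>\<^bsub>M\<^esub> n))}"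

definition fraction ::
  "('r, 'x) ring_scheme \<Rightarrow> ('r, 'm, 'y) module_scheme \<Rightarrow> 'r set \<Rightarrow> 'm \<Rightarrow> 'r \<Rightarrow> ('m \<times> 'r) set"
  where "fraction R M S m s = fraction_rel R M S `` {(m, s)}"

(* Only the module part of the record is meaningful; the ring multiplication and unit inherited
   from the record type are left undefined. As in Equiv_Relations, the union of the results over
   all representatives is the common class of these results (see smult_fraction and add_fraction). *)
definition localization ::
  "('r, 'x) ring_scheme \<Rightarrow> ('r, 'm, 'y) module_scheme \<Rightarrow> 'r set \<Rightarrow> ('r, ('m \<times> 'r) set) module"
  where "localization R M S =
    \<lparr> carrier = (carrier M \<times> S) // fraction_rel R M S,
      mult = undefined,
      one = undefined,
      zero = fraction R M S \<zero>\<^bsub>M\<^esub> \<one>\<^bsub>R\<^esub>,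
      add = (\<lambda>x y. \<Union>(m, s) \<in> x. \<Union>(n, t) \<in> y.
               fraction R M S (t \<odot>\<^bsub>M\<^esub> m \<oplus>\<^bsub>M\<^esub> s \<odot>\<^bsub>M\<^esub> n) (s \<otimes>\<^bsub>R\<^esub> t)),
      smult = (\<lambda>r x. \<Union>(m, s) \<in> x. fraction R M S (r \<odot>\<^bsub>M\<^esub> m) s) \<rparr>"

definition powers :: "('r, 'x) ring_scheme \<Rightarrow> 'r \<Rightarrow> 'r set"
  where "powers R f = {f [^]\<^bsub>R\<^esub> n | n :: nat. True}"

abbreviation localization_away ::
  "('r, 'x) ring_scheme \<Rightarrow> ('r, 'm, 'y) module_scheme \<Rightarrow> 'r \<Rightarrow> ('r, ('m \<times> 'r) set) module"
  where "localization_away R M f \<equiv> localization R M (powers R f)"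

abbreviation localization_at ::
  "('r, 'x) ring_scheme \<Rightarrow> ('r, 'm, 'y) module_scheme \<Rightarrow> 'r set \<Rightarrow> ('r, ('m \<times> 'r) set) module"
  where "localization_at R M p \<equiv> localization R M (carrier R - p)"


section \<open>The structure sheaf\<close>

(* A map into the coproduct of the stalks sending each P to the stalk at P is rendered as an
   element of the dependent product (extensional outside U). *)
definition sections ::
  "('r, 'x) ring_scheme \<Rightarrow> ('r, 'm, 'y) module_scheme \<Rightarrow> 'm set set \<Rightarrow> ('m set \<Rightarrow> ('m \<times> 'r) set) set"
  where "sections R M U =
    {s \<in> (\<Pi>\<^sub>E P \<in> U. carrier (localization_at R M (colon R M P))).
       \<forall>P \<in> U. \<exists>W m g. openin (zariski R M) W \<and> P \<in> W \<and> W \<subseteq> U \<and> m \<in> carrier M \<and> g \<in> carrier R \<and>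
         (\<forall>Q \<in> W. g \<notin> colon R M Q \<and> s Q = fraction R M (carrier R - colon R M Q) m g)}"

definition structure_sheaf ::
  "('r, 'x) ring_scheme \<Rightarrow> ('r, 'm, 'y) module_scheme \<Rightarrow> 'm set set
     \<Rightarrow> ('r, 'm set \<Rightarrow> ('m \<times> 'r) set) module"
  where "structure_sheaf R M U =
    \<lparr> carrier = sections R M U,
      mult = undefined,
      one = undefined,
      zero = (\<lambda>P \<in> U. \<zero>\<^bsub>localization_at R M (colon R M P)\<^esub>),
      add = (\<lambda>s t. \<lambda>P \<in> U. s P \<oplus>\<^bsub>localization_at R M (colon R M P)\<^esub> t P),
      smult = (\<lambda>r s. \<lambda>P \<in> U. r \<odot>\<^bsub>localization_at R M (colon R M P)\<^esub> s P) \<rparr>"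


section \<open>Well-definedness\<close>

context module
begin

lemma submodule_colon_ideal:
  assumes "submodule N R M" shows "ideal (colon R M N) R"
proof -
  note N = submoduleE[OF assms]
  have z: "\<zero>\<^bsub>M\<^esub> \<in> N"
    using N(1,2) N(4)[OF R.zero_closed] smult_l_null by (metis ex_in_conv subsetD)
  show ?thesis
  proof (rule idealI)
    show "ring R" by (rule R.ring_axioms)
    show "subgroup (colon R M N) (add_monoid R)"
    proof (rule R.add.subgroupI)
      show "colon R M N \<noteq> {}" using z by (auto simp: colon_def)
      fix a assume a: "a \<in> colon R M N"
      have "(\<ominus> a) \<odot>\<^bsub>M\<^esub> m \<in> N" if "m \<in> carrier M" for m
        using a that N(3) smult_l_minus[of a m] by (auto simp: colon_def)
      then show "\<ominus> a \<in> colon R M N" using a by (auto simp: colon_def)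
    qed (auto simp: colon_def smult_l_distr N(5))
    fix a x assume a: "a \<in> colon R M N" and x: "x \<in> carrier R"
    then have "x \<otimes> a \<in> colon R M N" by (auto simp: colon_def smult_assoc1 N(4))
    moreover from a x have "a \<otimes> x \<in> colon R M N" by (auto simp: colon_def smult_assoc1)
    ultimately show "x \<otimes> a \<in> colon R M N" "a \<otimes> x \<in> colon R M N" by auto
  qed
qed

lemma prime_colon:
  assumes "prime_submodule R M P" shows "primeideal (colon R M P) R"
proof (rule primeidealI)
  have sub: "submodule P R M" and ne: "P \<noteq> carrier M" using assms by (auto simp: prime_submodule_def)
  show "ideal (colon R M P) R" by (rule submodule_colon_ideal[OF sub])
  show "cring R" by (rule R.is_cring)
  show "carrier R \<noteq> colon R M P"
  proof
    assume "carrier R = colon R M P"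
    then have "\<one> \<in> colon R M P" by auto
    then have "carrier M \<subseteq> P" by (auto simp: colon_def)
    with ne submoduleE(1)[OF sub] show False by auto
  qed
  fix a b assume a: "a \<in> carrier R" and b: "b \<in> carrier R" and ab: "a \<otimes> b \<in> colon R M P"
  show "a \<in> colon R M P \<or> b \<in> colon R M P"
  proof (rule ccontr)
    assume "\<not> ?thesis"
    then obtain m where m: "m \<in> carrier M" "b \<odot>\<^bsub>M\<^esub> m \<notin> P" and na: "a \<notin> colon R M P"
      using b by (auto simp: colon_def)
    have "a \<odot>\<^bsub>M\<^esub> (b \<odot>\<^bsub>M\<^esub> m) \<in> P" using ab a b m by (auto simp: colon_def smult_assoc1)
    then show False using assms m a b na by (auto simp: prime_submodule_def colon_def)
  qed
qed

lemma submonoid_prime: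
  assumes "primeideal p R" shows "submonoid (carrier R - p) R"
proof -
  interpret primeideal p R by fact
  show ?thesis
    using I_prime I_notcarr one_imp_carrier by unfold_locales auto
qed

lemma submonoid_colon:
  "P \<in> Spec R M \<Longrightarrow> submonoid (carrier R - colon R M P) R"
  by (simp add: Spec_def prime_colon submonoid_prime)

lemma submonoid_powers:
  assumes "f \<in> carrier R" shows "submonoid (powers R f) R"
proof
  show "powers R f \<subseteq> carrier R" using assms by (auto simp: powers_def)
  show "\<one> \<in> powers R f" unfolding powers_def by (auto intro: exI[of _ "0::nat"])
  fix x y assume "x \<in> powers R f" "y \<in> powers R f"
  then obtain i j :: nat where "x = f [^] i" "y = f [^] j" by (auto simp: powers_def)
  then have "x \<otimes> y = f [^] (i + j)" using assms by (simp add: R.nat_pow_mult)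
  then show "x \<otimes> y \<in> powers R f" by (auto simp: powers_def)
qed

lemma smult_left_commute:
  "\<lbrakk>a \<in> carrier R; b \<in> carrier R; x \<in> carrier M\<rbrakk> \<Longrightarrow> a \<odot>\<^bsub>M\<^esub> (b \<odot>\<^bsub>M\<^esub> x) = b \<odot>\<^bsub>M\<^esub> (a \<odot>\<^bsub>M\<^esub> x)"
  by (metis R.m_comm smult_assoc1)

lemma equiv_fraction_rel:
  assumes "submonoid S R" shows "equiv (carrier M \<times> S) (fraction_rel R M S)"
proof -
  interpret S: submonoid S R by fact
  note SR = S.mem_carrier
  show ?thesis
  proof (rule equivI)
    show "fraction_rel R M S \<subseteq> (carrier M \<times> S) \<times> (carrier M \<times> S)" by (auto simp: fraction_rel_def)
    show "refl_on (carrier M \<times> S) (fraction_rel R M S)"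
      using S.one_closed by (auto simp: refl_on_def fraction_rel_def)
    show "sym (fraction_rel R M S)" by (auto simp: sym_def fraction_rel_def; metis)
    show "trans (fraction_rel R M S)"
    proof (rule transI, clarsimp simp: fraction_rel_def)
      fix m s n t k r u v
      assume M: "m \<in> carrier M" "n \<in> carrier M" "k \<in> carrier M"
        and S: "s \<in> S" "t \<in> S" "r \<in> S" "u \<in> S" "v \<in> S"
        and e1: "u \<odot>\<^bsub>M\<^esub> (t \<odot>\<^bsub>M\<^esub> m) = u \<odot>\<^bsub>M\<^esub> (s \<odot>\<^bsub>M\<^esub> n)"
        and e2: "v \<odot>\<^bsub>M\<^esub> (r \<odot>\<^bsub>M\<^esub> n) = v \<odot>\<^bsub>M\<^esub> (t \<odot>\<^bsub>M\<^esub> k)"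
      note c = M S[THEN SR] smult_assoc1
      have "(u \<otimes> v \<otimes> t) \<odot>\<^bsub>M\<^esub> (r \<odot>\<^bsub>M\<^esub> m) = r \<odot>\<^bsub>M\<^esub> (v \<odot>\<^bsub>M\<^esub> (u \<odot>\<^bsub>M\<^esub> (t \<odot>\<^bsub>M\<^esub> m)))"
        using c by (simp add: smult_left_commute)
      also have "\<dots> = r \<odot>\<^bsub>M\<^esub> (v \<odot>\<^bsub>M\<^esub> (u \<odot>\<^bsub>M\<^esub> (s \<odot>\<^bsub>M\<^esub> n)))" by (simp only: e1)
      also have "\<dots> = u \<odot>\<^bsub>M\<^esub> (s \<odot>\<^bsub>M\<^esub> (v \<odot>\<^bsub>M\<^esub> (r \<odot>\<^bsub>M\<^esub> n)))"
        using c by (simp add: smult_left_commute)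
      also have "\<dots> = u \<odot>\<^bsub>M\<^esub> (s \<odot>\<^bsub>M\<^esub> (v \<odot>\<^bsub>M\<^esub> (t \<odot>\<^bsub>M\<^esub> k)))" by (simp only: e2)
      also have "\<dots> = (u \<otimes> v \<otimes> t) \<odot>\<^bsub>M\<^esub> (s \<odot>\<^bsub>M\<^esub> k)"
        using c by (simp add: smult_left_commute)
      finally show "\<exists>u\<in>S. u \<odot>\<^bsub>M\<^esub> (r \<odot>\<^bsub>M\<^esub> m) = u \<odot>\<^bsub>M\<^esub> (s \<odot>\<^bsub>M\<^esub> k)"
        using S S.m_closed by blast
    qed
  qed
qed

lemma fraction_eq_iff:
  assumes "submonoid S R" "m \<in> carrier M" "s \<in> S" "n \<in> carrier M" "t \<in> S"
  shows "fraction R M S m s = fraction R M S n t \<longleftrightarrow>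
    (\<exists>u \<in> S. u \<odot>\<^bsub>M\<^esub> (t \<odot>\<^bsub>M\<^esub> m) = u \<odot>\<^bsub>M\<^esub> (s \<odot>\<^bsub>M\<^esub> n))"
proof -
  have "fraction R M S m s = fraction R M S n t \<longleftrightarrow> ((m, s), (n, t)) \<in> fraction_rel R M S"
    unfolding fraction_def using equiv_fraction_rel[OF assms(1)] assms by (intro eq_equiv_class_iff) auto
  then show ?thesis using assms by (auto simp: fraction_rel_def)
qed

lemma fraction_closed:
  "\<lbrakk>m \<in> carrier M; s \<in> S\<rbrakk> \<Longrightarrow> fraction R M S m s \<in> carrier (localization R M S)"
  by (auto simp: localization_def fraction_def quotient_def)

lemma localization_cases:
  assumes "x \<in> carrier (localization R M S)"
  obtains m s where "m \<in> carrier M" "s \<in> S" "x = fraction R M S m s"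
  using assms by (auto simp: localization_def fraction_def quotient_def)

lemma smult_fraction:
  assumes S: "submonoid S R" and r: "r \<in> carrier R" and m: "m \<in> carrier M" and s: "s \<in> S"
  shows "r \<odot>\<^bsub>localization R M S\<^esub> fraction R M S m s = fraction R M S (r \<odot>\<^bsub>M\<^esub> m) s"
proof -
  interpret S: submonoid S R by fact
  have "(\<lambda>(m, s). fraction R M S (r \<odot>\<^bsub>M\<^esub> m) s) respects fraction_rel R M S"
  proof (rule congruentI, clarsimp simp: fraction_rel_def)
    fix m s n t u
    assume M: "m \<in> carrier M" "n \<in> carrier M" and S': "s \<in> S" "t \<in> S" "u \<in> S"
      and e: "u \<odot>\<^bsub>M\<^esub> (t \<odot>\<^bsub>M\<^esub> m) = u \<odot>\<^bsub>M\<^esub> (s \<odot>\<^bsub>M\<^esub> n)"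
    note SR = S'[THEN S.mem_carrier]
    have "u \<odot>\<^bsub>M\<^esub> (t \<odot>\<^bsub>M\<^esub> (r \<odot>\<^bsub>M\<^esub> m)) = r \<odot>\<^bsub>M\<^esub> (u \<odot>\<^bsub>M\<^esub> (t \<odot>\<^bsub>M\<^esub> m))"
      using M SR r by (simp add: smult_left_commute)
    also have "\<dots> = u \<odot>\<^bsub>M\<^esub> (s \<odot>\<^bsub>M\<^esub> (r \<odot>\<^bsub>M\<^esub> n))"
      unfolding e using M SR r by (simp add: smult_left_commute)
    finally show "fraction R M S (r \<odot>\<^bsub>M\<^esub> m) s = fraction R M S (r \<odot>\<^bsub>M\<^esub> n) t"
      using M S' r by (subst fraction_eq_iff[OF S]) auto
  qed
  from UN_equiv_class[OF equiv_fraction_rel[OF S] this, of "(m, s)"] m s show ?thesis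
    by (simp add: localization_def fraction_def[of R M S m s])
qed

lemma add_fraction:
  assumes S: "submonoid S R" and m: "m \<in> carrier M" "n \<in> carrier M" and s: "s \<in> S" "t \<in> S"
  shows "fraction R M S m s \<oplus>\<^bsub>localization R M S\<^esub> fraction R M S n t =
    fraction R M S (t \<odot>\<^bsub>M\<^esub> m \<oplus>\<^bsub>M\<^esub> s \<odot>\<^bsub>M\<^esub> n) (s \<otimes> t)"
proof -
  interpret S: submonoid S R by fact
  let ?f = "\<lambda>(m, s) (n, t). fraction R M S (t \<odot>\<^bsub>M\<^esub> m \<oplus>\<^bsub>M\<^esub> s \<odot>\<^bsub>M\<^esub> n) (s \<otimes> t)"
  have "?f respects2 fraction_rel R M S"
  proof (rule congruent2I[OF equiv_fraction_rel[OF S] equiv_fraction_rel[OF S]]; clarsimp simp: fraction_rel_def)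
    fix m s n t k r u
    assume M: "m \<in> carrier M" "n \<in> carrier M" "k \<in> carrier M"
      and S': "s \<in> S" "t \<in> S" "r \<in> S" "u \<in> S"
      and e: "u \<odot>\<^bsub>M\<^esub> (t \<odot>\<^bsub>M\<^esub> m) = u \<odot>\<^bsub>M\<^esub> (s \<odot>\<^bsub>M\<^esub> n)"
    note SR = S'[THEN S.mem_carrier]
    have e': "u \<odot>\<^bsub>M\<^esub> (t \<odot>\<^bsub>M\<^esub> (r \<odot>\<^bsub>M\<^esub> (r \<odot>\<^bsub>M\<^esub> m))) = u \<odot>\<^bsub>M\<^esub> (s \<odot>\<^bsub>M\<^esub> (r \<odot>\<^bsub>M\<^esub> (r \<odot>\<^bsub>M\<^esub> n)))"
    proof -
      have "u \<odot>\<^bsub>M\<^esub> (t \<odot>\<^bsub>M\<^esub> (r \<odot>\<^bsub>M\<^esub> (r \<odot>\<^bsub>M\<^esub> m))) = r \<odot>\<^bsub>M\<^esub> (r \<odot>\<^bsub>M\<^esub> (u \<odot>\<^bsub>M\<^esub> (t \<odot>\<^bsub>M\<^esub> m)))"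
        using M SR by (simp add: smult_left_commute)
      also have "\<dots> = u \<odot>\<^bsub>M\<^esub> (s \<odot>\<^bsub>M\<^esub> (r \<odot>\<^bsub>M\<^esub> (r \<odot>\<^bsub>M\<^esub> n)))"
        unfolding e using M SR by (simp add: smult_left_commute)
      finally show ?thesis .
    qed
    have 1: "u \<odot>\<^bsub>M\<^esub> ((t \<otimes> r) \<odot>\<^bsub>M\<^esub> (r \<odot>\<^bsub>M\<^esub> m \<oplus>\<^bsub>M\<^esub> s \<odot>\<^bsub>M\<^esub> k)) =
        u \<odot>\<^bsub>M\<^esub> (t \<odot>\<^bsub>M\<^esub> (r \<odot>\<^bsub>M\<^esub> (r \<odot>\<^bsub>M\<^esub> m))) \<oplus>\<^bsub>M\<^esub> u \<odot>\<^bsub>M\<^esub> (t \<odot>\<^bsub>M\<^esub> (r \<odot>\<^bsub>M\<^esub> (s \<odot>\<^bsub>M\<^esub> k)))"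
      using M SR by (simp add: smult_r_distr smult_assoc1)
    have 2: "u \<odot>\<^bsub>M\<^esub> ((s \<otimes> r) \<odot>\<^bsub>M\<^esub> (r \<odot>\<^bsub>M\<^esub> n \<oplus>\<^bsub>M\<^esub> t \<odot>\<^bsub>M\<^esub> k)) =
        u \<odot>\<^bsub>M\<^esub> (s \<odot>\<^bsub>M\<^esub> (r \<odot>\<^bsub>M\<^esub> (r \<odot>\<^bsub>M\<^esub> n))) \<oplus>\<^bsub>M\<^esub> u \<odot>\<^bsub>M\<^esub> (s \<odot>\<^bsub>M\<^esub> (r \<odot>\<^bsub>M\<^esub> (t \<odot>\<^bsub>M\<^esub> k)))"
      using M SR by (simp add: smult_r_distr smult_assoc1)
    have 3: "u \<odot>\<^bsub>M\<^esub> (t \<odot>\<^bsub>M\<^esub> (r \<odot>\<^bsub>M\<^esub> (s \<odot>\<^bsub>M\<^esub> k))) = u \<odot>\<^bsub>M\<^esub> (s \<odot>\<^bsub>M\<^esub> (r \<odot>\<^bsub>M\<^esub> (t \<odot>\<^bsub>M\<^esub> k)))"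
      using M SR by (simp add: smult_left_commute)
    have eq: "u \<odot>\<^bsub>M\<^esub> ((t \<otimes> r) \<odot>\<^bsub>M\<^esub> (r \<odot>\<^bsub>M\<^esub> m \<oplus>\<^bsub>M\<^esub> s \<odot>\<^bsub>M\<^esub> k)) = u \<odot>\<^bsub>M\<^esub> ((s \<otimes> r) \<odot>\<^bsub>M\<^esub> (r \<odot>\<^bsub>M\<^esub> n \<oplus>\<^bsub>M\<^esub> t \<odot>\<^bsub>M\<^esub> k))"
      unfolding 1 2 3 e' ..
    show "fraction R M S (r \<odot>\<^bsub>M\<^esub> m \<oplus>\<^bsub>M\<^esub> s \<odot>\<^bsub>M\<^esub> k) (s \<otimes> r) = fraction R M S (r \<odot>\<^bsub>M\<^esub> n \<oplus>\<^bsub>M\<^esub> t \<odot>\<^bsub>M\<^esub> k) (t \<otimes> r)"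
      using M SR S' eq by (subst fraction_eq_iff[OF S]) auto
    then show "fraction R M S (s \<odot>\<^bsub>M\<^esub> k \<oplus>\<^bsub>M\<^esub> r \<odot>\<^bsub>M\<^esub> m) (r \<otimes> s) = fraction R M S (t \<odot>\<^bsub>M\<^esub> k \<oplus>\<^bsub>M\<^esub> r \<odot>\<^bsub>M\<^esub> n) (r \<otimes> t)"
      using M SR by (simp only: M.a_comm[of "s \<odot>\<^bsub>M\<^esub> k" "r \<odot>\<^bsub>M\<^esub> m"] M.a_comm[of "t \<odot>\<^bsub>M\<^esub> k" "r \<odot>\<^bsub>M\<^esub> n"]
          R.m_comm[of r s] R.m_comm[of r t] smult_closed)
  qed
  from UN_equiv_class2[OF equiv_fraction_rel[OF S] equiv_fraction_rel[OF S] this, of "(m, s)" "(n, t)"] m s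
  show ?thesis
    by (simp add: localization_def fraction_def[of R M S m s] fraction_def[of R M S n t] case_prod_unfold)
qed

lemma colon_subset_colon_iff:
  assumes "submodule P R M" "submodule N R M"
  shows "colon R M N \<subseteq> colon R M P \<longleftrightarrow> ideal_times R M (colon R M N) \<subseteq> P"
proof
  assume "colon R M N \<subseteq> colon R M P"
  then have "{a \<odot>\<^bsub>M\<^esub> m | a m. a \<in> colon R M N \<and> m \<in> carrier M} \<subseteq> P"
    by (auto simp: colon_def)
  then show "ideal_times R M (colon R M N) \<subseteq> P"
    using assms(1) by (auto simp: ideal_times_def submodule_generated_def)
next
  assume "ideal_times R M (colon R M N) \<subseteq> P"
  moreover have "a \<odot>\<^bsub>M\<^esub> m \<in> ideal_times R M (colon R M N)"
    if "a \<in> colon R M N" "m \<in> carrier M" for a m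
    using that by (auto simp: ideal_times_def submodule_generated_def)
  ultimately show "colon R M N \<subseteq> colon R M P"
    by (auto simp: colon_def)
qed

lemma submodule_Inter:
  assumes N: "\<And>N. N \<in> \<N> \<Longrightarrow> submodule N R M" and ne: "\<N> \<noteq> {}"
  shows "submodule (\<Inter>\<N>) R M"
proof (rule submoduleI)
  show "\<Inter>\<N> \<subseteq> carrier M" using ne submoduleE(1)[OF N] by auto
  show "\<zero>\<^bsub>M\<^esub> \<in> \<Inter>\<N>"
    using subgroup.one_closed[OF submodule.axioms(1)[OF N]] by auto
  show "\<ominus>\<^bsub>M\<^esub> a \<in> \<Inter>\<N>" if "a \<in> \<Inter>\<N>" for a
    using that submoduleE(3)[OF N] by auto
  show "a \<oplus>\<^bsub>M\<^esub> b \<in> \<Inter>\<N>" if "a \<in> \<Inter>\<N>" "b \<in> \<Inter>\<N>" for a b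
    using that submoduleE(5)[OF N] by auto
  show "a \<odot>\<^bsub>M\<^esub> x \<in> \<Inter>\<N>" if "a \<in> carrier R" "x \<in> \<Inter>\<N>" for a x
    using that submoduleE(4)[OF N] by auto
qed

lemma submodule_generated:
  assumes "X \<subseteq> carrier M" shows "submodule (submodule_generated R M X) R M"
  unfolding submodule_generated_def
  using assms carrier_is_submodule by (intro submodule_Inter) auto

lemma istopology_zariski:
  "istopology (\<lambda>U. \<exists>N. submodule N R M \<and> U = Spec R M - V R M N)"
  unfolding istopology_def
proof (intro conjI allI impI)
  fix A B
  assume "\<exists>N. submodule N R M \<and> A = Spec R M - V R M N"
    and "\<exists>N. submodule N R M \<and> B = Spec R M - V R M N"
  then obtain N K where N: "submodule N R M" "A = Spec R M - V R M N"
    and K: "submodule K R M" "B = Spec R M - V R M K" by (elim exE conjE)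
  have "submodule (\<Inter>{N, K}) R M"
  proof (rule submodule_Inter)
    show "submodule L R M" if "L \<in> {N, K}" for L
      using that N(1) K(1) by (elim insertE) simp_all
  qed simp
  then have "submodule (N \<inter> K) R M" by simp
  moreover have "V R M (N \<inter> K) = V R M N \<union> V R M K"
  proof -
    have "colon R M (N \<inter> K) \<subseteq> colon R M P \<longleftrightarrow>
        colon R M N \<subseteq> colon R M P \<or> colon R M K \<subseteq> colon R M P" if "P \<in> Spec R M" for P
    proof
      assume "colon R M N \<subseteq> colon R M P \<or> colon R M K \<subseteq> colon R M P"
      moreover have "colon R M (N \<inter> K) \<subseteq> colon R M N" "colon R M (N \<inter> K) \<subseteq> colon R M K"
        by (auto simp: colon_def)
      ultimately show "colon R M (N \<inter> K) \<subseteq> colon R M P" by blast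
    next
      have P: "primeideal (colon R M P) R" using that by (simp add: Spec_def prime_colon)
      assume le: "colon R M (N \<inter> K) \<subseteq> colon R M P"
      show "colon R M N \<subseteq> colon R M P \<or> colon R M K \<subseteq> colon R M P"
      proof (rule ccontr)
        assume "\<not> ?thesis"
        then obtain a b where a: "a \<in> colon R M N" "a \<notin> colon R M P"
          and b: "b \<in> colon R M K" "b \<notin> colon R M P"
          by blast
        have c: "a \<in> carrier R" "b \<in> carrier R" using a(1) b(1) by (simp_all add: colon_def)
        have "a \<otimes> b \<in> colon R M N"
          by (rule ideal.I_r_closed[OF submodule_colon_ideal[OF N(1)] a(1) c(2)])
        moreover have "a \<otimes> b \<in> colon R M K"
          by (rule ideal.I_l_closed[OF submodule_colon_ideal[OF K(1)] b(1) c(1)])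
        ultimately have "a \<otimes> b \<in> colon R M (N \<inter> K)" by (simp add: colon_def)
        then have "a \<otimes> b \<in> colon R M P" using le by (rule rev_subsetD)
        then show False using primeideal.I_prime[OF P c] a(2) b(2) by simp
      qed
    qed
    then show ?thesis by (auto simp: V_def)
  qed
  moreover from this have "A \<inter> B = Spec R M - V R M (N \<inter> K)"
    unfolding N(2) K(2) by auto
  ultimately show "\<exists>N. submodule N R M \<and> A \<inter> B = Spec R M - V R M N"
    by (intro exI conjI)
next
  fix \<K> assume "\<forall>K\<in>\<K>. \<exists>N. submodule N R M \<and> K = Spec R M - V R M N"
  then have "\<exists>N. \<forall>K\<in>\<K>. submodule (N K) R M \<and> K = Spec R M - V R M (N K)"
    by (rule bchoice)
  then obtain N where N: "\<And>K. K \<in> \<K> \<Longrightarrow> submodule (N K) R M"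
      "\<And>K. K \<in> \<K> \<Longrightarrow> K = Spec R M - V R M (N K)" by blast
  let ?X = "\<Union>K \<in> \<K>. ideal_times R M (colon R M (N K))"
  let ?L = "submodule_generated R M ?X"
  have "ideal_times R M (colon R M (N K)) \<subseteq> carrier M" if "K \<in> \<K>" for K
    unfolding ideal_times_def
    by (rule submoduleE(1)[OF submodule_generated]) (auto simp: colon_def)
  then have X: "?X \<subseteq> carrier M" by auto
  have L: "submodule ?L R M" by (rule submodule_generated[OF X])
  have XL: "?X \<subseteq> ?L" by (auto simp: submodule_generated_def)
  have "P \<in> V R M ?L \<longleftrightarrow> (\<forall>K \<in> \<K>. P \<in> V R M (N K))" if P: "P \<in> Spec R M" for P
  proof -
    have PS: "submodule P R M" using P by (auto simp: Spec_def prime_submodule_def)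
    have "colon R M ?L \<subseteq> colon R M P \<longleftrightarrow> (\<forall>K \<in> \<K>. colon R M (N K) \<subseteq> colon R M P)"
    proof
      assume le: "colon R M ?L \<subseteq> colon R M P"
      have "colon R M (N K) \<subseteq> colon R M ?L" if K: "K \<in> \<K>" for K
      proof -
        have "ideal_times R M (colon R M (N K)) \<subseteq> ?L" using XL K by blast
        then show ?thesis using colon_subset_colon_iff[OF L N(1)[OF K]] by simp
      qed
      then show "\<forall>K \<in> \<K>. colon R M (N K) \<subseteq> colon R M P" using le by blast
    next
      assume le: "\<forall>K \<in> \<K>. colon R M (N K) \<subseteq> colon R M P"
      have "ideal_times R M (colon R M (N K)) \<subseteq> P" if K: "K \<in> \<K>" for K
        using colon_subset_colon_iff[OF PS N(1)[OF K]] le K by simp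
      then have "?X \<subseteq> P" by blast
      then have "?L \<subseteq> P" using PS by (auto simp: submodule_generated_def)
      then show "colon R M ?L \<subseteq> colon R M P" by (auto simp: colon_def)
    qed
    then show ?thesis using P by (auto simp: V_def)
  qed
  moreover have "P \<in> \<Union>\<K> \<longleftrightarrow> P \<in> Spec R M \<and> (\<exists>K \<in> \<K>. P \<notin> V R M (N K))" for P
  proof -
    have "P \<in> K \<longleftrightarrow> P \<in> Spec R M \<and> P \<notin> V R M (N K)" if "K \<in> \<K>" for K
      using N(2)[OF that] by (metis DiffE DiffI)
    then show ?thesis by blast
  qed
  ultimately have "\<Union>\<K> = Spec R M - V R M ?L" by blast
  then show "\<exists>N. submodule N R M \<and> \<Union>\<K> = Spec R M - V R M N" using L by blast
qed

lemma openin_zariski: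
  "openin (zariski R M) U \<longleftrightarrow> (\<exists>N. submodule N R M \<and> U = Spec R M - V R M N)"
  unfolding zariski_def by (simp add: topology_inverse'[OF istopology_zariski])

lemma submodule_smult_image:
  assumes "f \<in> carrier R" shows "submodule {f \<odot>\<^bsub>M\<^esub> m | m. m \<in> carrier M} R M"
proof (rule submoduleI)
  show "\<zero>\<^bsub>M\<^esub> \<in> {f \<odot>\<^bsub>M\<^esub> m | m. m \<in> carrier M}"
    using assms by (auto intro!: exI[of _ "\<zero>\<^bsub>M\<^esub>"])
  show "\<ominus>\<^bsub>M\<^esub> a \<in> {f \<odot>\<^bsub>M\<^esub> m | m. m \<in> carrier M}" if "a \<in> {f \<odot>\<^bsub>M\<^esub> m | m. m \<in> carrier M}" for a
    using that assms by (auto simp: smult_r_minus[symmetric])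
  show "a \<oplus>\<^bsub>M\<^esub> b \<in> {f \<odot>\<^bsub>M\<^esub> m | m. m \<in> carrier M}"
    if "a \<in> {f \<odot>\<^bsub>M\<^esub> m | m. m \<in> carrier M}" "b \<in> {f \<odot>\<^bsub>M\<^esub> m | m. m \<in> carrier M}" for a b
    using that assms by (auto simp: smult_r_distr[symmetric])
  show "a \<odot>\<^bsub>M\<^esub> x \<in> {f \<odot>\<^bsub>M\<^esub> m | m. m \<in> carrier M}"
    if "a \<in> carrier R" "x \<in> {f \<odot>\<^bsub>M\<^esub> m | m. m \<in> carrier M}" for a x
    using that assms by (auto simp: smult_left_commute[of a f])
qed (use assms in auto)

lemma basic_open_eq:
  assumes "f \<in> carrier R" shows "basic_open R M f = {P \<in> Spec R M. f \<notin> colon R M P}"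
proof -
  have "colon R M {f \<odot>\<^bsub>M\<^esub> m | m. m \<in> carrier M} \<subseteq> colon R M P \<longleftrightarrow> f \<in> colon R M P" for P
    using assms by (auto simp: colon_def)
  then show ?thesis by (auto simp: basic_open_def V_def)
qed

lemma openin_basic_open: "f \<in> carrier R \<Longrightarrow> openin (zariski R M) (basic_open R M f)"
  unfolding openin_zariski basic_open_def using submodule_smult_image by blast

lemma openin_Spec: "openin (zariski R M) (Spec R M)"
proof -
  have "basic_open R M \<one> = Spec R M"
    using submoduleE(1) by (fastforce simp: basic_open_eq Spec_def prime_submodule_def colon_def)
  then show ?thesis using openin_basic_open[OF R.one_closed] by simp
qed

lemma module_localization:
  assumes S: "submonoid S R" shows "module R (localization R M S)"
proof -
  interpret S: submonoid S R by fact
  note SR = S.mem_carrier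
  let ?L = "localization R M S"
  have zero: "\<zero>\<^bsub>?L\<^esub> = fraction R M S \<zero>\<^bsub>M\<^esub> \<one>" by (simp add: localization_def)
  note ops = smult_fraction[OF S] add_fraction[OF S] zero
  have I: "fraction R M S m s = fraction R M S n t"
    if "m \<in> carrier M" "s \<in> S" "n \<in> carrier M" "t \<in> S" "t \<odot>\<^bsub>M\<^esub> m = s \<odot>\<^bsub>M\<^esub> n" for m s n t
    using that S.one_closed by (subst fraction_eq_iff[OF S]) auto
  note simps = smult_r_distr smult_l_distr smult_assoc1 smult_left_commute SR S.m_closed
    M.a_ac R.m_ac
  show ?thesis
  proof (rule moduleI)
    show "cring R" by (rule R.is_cring)
    show "abelian_group ?L"
    proof (rule abelian_groupI)
      fix x y assume "x \<in> carrier ?L" "y \<in> carrier ?L"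
      then show "x \<oplus>\<^bsub>?L\<^esub> y \<in> carrier ?L"
        by (elim localization_cases) (simp add: ops fraction_closed SR)
    next
      show "\<zero>\<^bsub>?L\<^esub> \<in> carrier ?L" by (simp add: zero fraction_closed)
    next
      fix x y z assume "x \<in> carrier ?L" "y \<in> carrier ?L" "z \<in> carrier ?L"
      then show "x \<oplus>\<^bsub>?L\<^esub> y \<oplus>\<^bsub>?L\<^esub> z = x \<oplus>\<^bsub>?L\<^esub> (y \<oplus>\<^bsub>?L\<^esub> z)"
        by (elim localization_cases, simp add: ops SR) (rule I; simp add: simps)
    next
      fix x y assume "x \<in> carrier ?L" "y \<in> carrier ?L"
      then show "x \<oplus>\<^bsub>?L\<^esub> y = y \<oplus>\<^bsub>?L\<^esub> x"
        by (elim localization_cases, simp add: ops SR) (rule I; simp add: simps)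
    next
      fix x assume "x \<in> carrier ?L"
      then show "\<zero>\<^bsub>?L\<^esub> \<oplus>\<^bsub>?L\<^esub> x = x"
        by (elim localization_cases) (simp add: ops SR)
    next
      fix x assume "x \<in> carrier ?L"
      then obtain m s where x: "m \<in> carrier M" "s \<in> S" "x = fraction R M S m s" by (rule localization_cases)
      have "s \<odot>\<^bsub>M\<^esub> (\<ominus>\<^bsub>M\<^esub> m) \<oplus>\<^bsub>M\<^esub> s \<odot>\<^bsub>M\<^esub> m = \<zero>\<^bsub>M\<^esub>"
        using x by (simp add: smult_r_distr[symmetric] SR M.l_neg)
      then have "fraction R M S (\<ominus>\<^bsub>M\<^esub> m) s \<oplus>\<^bsub>?L\<^esub> x = \<zero>\<^bsub>?L\<^esub>"
        using x I[of "\<zero>\<^bsub>M\<^esub>" "s \<otimes> s" "\<zero>\<^bsub>M\<^esub>" \<one>] by (simp add: ops SR)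
      moreover have "fraction R M S (\<ominus>\<^bsub>M\<^esub> m) s \<in> carrier ?L"
        using x by (intro fraction_closed) auto
      ultimately show "\<exists>y\<in>carrier ?L. y \<oplus>\<^bsub>?L\<^esub> x = \<zero>\<^bsub>?L\<^esub>"
        by (rule bexI)
    qed
  next
    fix a x assume "a \<in> carrier R" "x \<in> carrier ?L"
    then show "a \<odot>\<^bsub>?L\<^esub> x \<in> carrier ?L"
      by (elim localization_cases) (simp add: ops fraction_closed)
  next
    fix a b x assume "a \<in> carrier R" "b \<in> carrier R" "x \<in> carrier ?L"
    then show "(a \<oplus> b) \<odot>\<^bsub>?L\<^esub> x = a \<odot>\<^bsub>?L\<^esub> x \<oplus>\<^bsub>?L\<^esub> b \<odot>\<^bsub>?L\<^esub> x"
      by (elim localization_cases, simp add: ops SR) (rule I; simp add: simps)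
  next
    fix a x y assume "a \<in> carrier R" "x \<in> carrier ?L" "y \<in> carrier ?L"
    then show "a \<odot>\<^bsub>?L\<^esub> (x \<oplus>\<^bsub>?L\<^esub> y) = a \<odot>\<^bsub>?L\<^esub> x \<oplus>\<^bsub>?L\<^esub> a \<odot>\<^bsub>?L\<^esub> y"
      by (elim localization_cases, simp add: ops SR) (rule I; simp add: simps)
  next
    fix a b x assume "a \<in> carrier R" "b \<in> carrier R" "x \<in> carrier ?L"
    then show "(a \<otimes> b) \<odot>\<^bsub>?L\<^esub> x = a \<odot>\<^bsub>?L\<^esub> (b \<odot>\<^bsub>?L\<^esub> x)"
      by (elim localization_cases) (simp add: ops smult_assoc1)
  next
    fix x assume "x \<in> carrier ?L"
    then show "\<one> \<odot>\<^bsub>?L\<^esub> x = x"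
      by (elim localization_cases) (simp add: ops)
  qed
qed

lemma sections_stalk:
  "\<lbrakk>s \<in> sections R M U; P \<in> U\<rbrakk> \<Longrightarrow> s P \<in> carrier (localization_at R M (colon R M P))"
  by (auto simp: sections_def)

lemma sections_ext:
  "\<lbrakk>s \<in> sections R M U; t \<in> sections R M U; \<And>P. P \<in> U \<Longrightarrow> s P = t P\<rbrakk> \<Longrightarrow> s = t"
  unfolding sections_def mem_Collect_eq by (elim conjE, rule PiE_ext)

lemma sectionsE:
  assumes "s \<in> sections R M U" "P \<in> U"
  obtains W m g where "openin (zariski R M) W" "P \<in> W" "W \<subseteq> U" "m \<in> carrier M" "g \<in> carrier R"
    "\<And>Q. Q \<in> W \<Longrightarrow> g \<notin> colon R M Q"
    "\<And>Q. Q \<in> W \<Longrightarrow> s Q = fraction R M (carrier R - colon R M Q) m g"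
proof -
  from assms have "\<exists>W m g. openin (zariski R M) W \<and> P \<in> W \<and> W \<subseteq> U \<and> m \<in> carrier M \<and> g \<in> carrier R \<and>
      (\<forall>Q \<in> W. g \<notin> colon R M Q \<and> s Q = fraction R M (carrier R - colon R M Q) m g)"
    unfolding sections_def mem_Collect_eq by (elim conjE) (erule bspec)
  then show thesis using that by (elim exE conjE) metis
qed

lemma sectionsI:
  assumes "s \<in> extensional U"
    and "\<And>P. P \<in> U \<Longrightarrow> \<exists>W m g. openin (zariski R M) W \<and> P \<in> W \<and> W \<subseteq> U \<and> m \<in> carrier M \<and> g \<in> carrier R \<and>
         (\<forall>Q \<in> W. g \<notin> colon R M Q \<and> s Q = fraction R M (carrier R - colon R M Q) m g)"
  shows "s \<in> sections R M U"
proof -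
  have "s P \<in> carrier (localization_at R M (colon R M P))" if P: "P \<in> U" for P
  proof -
    from assms(2)[OF P] obtain W m g where "P \<in> W" "m \<in> carrier M" "g \<in> carrier R"
      and W: "\<forall>Q \<in> W. g \<notin> colon R M Q \<and> s Q = fraction R M (carrier R - colon R M Q) m g"
      by (elim exE conjE)
    moreover from bspec[OF W \<open>P \<in> W\<close>] have "g \<notin> colon R M P"
      "s P = fraction R M (carrier R - colon R M P) m g" by simp_all
    ultimately show ?thesis using fraction_closed[of m g "carrier R - colon R M P"] by simp
  qed
  then have "s \<in> (\<Pi>\<^sub>E P \<in> U. carrier (localization_at R M (colon R M P)))"
    using assms(1) by (simp add: PiE_def)
  then show ?thesis
    unfolding sections_def mem_Collect_eq using assms(2) by (intro conjI ballI)
qed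

lemma module_structure_sheaf:
  assumes U: "openin (zariski R M) U" shows "module R (structure_sheaf R M U)"
proof -
  let ?O = "structure_sheaf R M U" and ?L = "\<lambda>P. localization_at R M (colon R M P)"
  have US: "P \<in> Spec R M" if "P \<in> U" for P using U that by (auto simp: openin_zariski)
  have mon: "submonoid (carrier R - colon R M P) R" if "P \<in> U" for P
    using submonoid_colon US that by blast
  have mod: "module R (?L P)" if "P \<in> U" for P
    using module_localization mon that by blast
  note grp = mod[THEN module.axioms(2)]
  have car: "carrier ?O = sections R M U" by (simp add: structure_sheaf_def)
  have zero: "\<zero>\<^bsub>?O\<^esub> P = \<zero>\<^bsub>?L P\<^esub>" if "P \<in> U" for P
    using that by (simp add: structure_sheaf_def)
  have add: "(s \<oplus>\<^bsub>?O\<^esub> t) P = s P \<oplus>\<^bsub>?L P\<^esub> t P" if "P \<in> U" for s t P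
    using that by (simp add: structure_sheaf_def)
  have smult: "(r \<odot>\<^bsub>?O\<^esub> s) P = r \<odot>\<^bsub>?L P\<^esub> s P" if "P \<in> U" for r s P
    using that by (simp add: structure_sheaf_def)
  have zero_closed: "\<zero>\<^bsub>?O\<^esub> \<in> sections R M U"
  proof (rule sectionsI)
    show "\<zero>\<^bsub>?O\<^esub> \<in> extensional U" by (simp add: structure_sheaf_def)
    fix P assume P: "P \<in> U"
    show "\<exists>W m g. openin (zariski R M) W \<and> P \<in> W \<and> W \<subseteq> U \<and> m \<in> carrier M \<and> g \<in> carrier R \<and>
         (\<forall>Q \<in> W. g \<notin> colon R M Q \<and> \<zero>\<^bsub>?O\<^esub> Q = fraction R M (carrier R - colon R M Q) m g)"
      using U P submonoid.one_closed[OF mon]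
      by (intro exI[of _ U] exI[of _ "\<zero>\<^bsub>M\<^esub>"] exI[of _ \<one>]) (auto simp: zero localization_def)
  qed
  have add_closed: "s \<oplus>\<^bsub>?O\<^esub> t \<in> sections R M U" if s: "s \<in> sections R M U" and t: "t \<in> sections R M U" for s t
  proof (rule sectionsI)
    show "s \<oplus>\<^bsub>?O\<^esub> t \<in> extensional U" by (simp add: structure_sheaf_def)
    fix P assume P: "P \<in> U"
    obtain W m g where W: "openin (zariski R M) W" "P \<in> W" "W \<subseteq> U" "m \<in> carrier M" "g \<in> carrier R"
      "\<And>Q. Q \<in> W \<Longrightarrow> g \<notin> colon R M Q" "\<And>Q. Q \<in> W \<Longrightarrow> s Q = fraction R M (carrier R - colon R M Q) m g"
      using sectionsE[OF s P] by metis
    obtain W' n h where W': "openin (zariski R M) W'" "P \<in> W'" "W' \<subseteq> U" "n \<in> carrier M" "h \<in> carrier R"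
      "\<And>Q. Q \<in> W' \<Longrightarrow> h \<notin> colon R M Q" "\<And>Q. Q \<in> W' \<Longrightarrow> t Q = fraction R M (carrier R - colon R M Q) n h"
      using sectionsE[OF t P] by metis
    have "g \<otimes> h \<notin> colon R M Q \<and>
        (s \<oplus>\<^bsub>?O\<^esub> t) Q = fraction R M (carrier R - colon R M Q) (h \<odot>\<^bsub>M\<^esub> m \<oplus>\<^bsub>M\<^esub> g \<odot>\<^bsub>M\<^esub> n) (g \<otimes> h)"
      if Q: "Q \<in> W \<inter> W'" for Q
    proof -
      have QU: "Q \<in> U" using Q W(3) by auto
      have gh: "g \<in> carrier R - colon R M Q" "h \<in> carrier R - colon R M Q"
        using Q W(5,6) W'(5,6) by auto
      show ?thesis
        using submonoid.m_closed[OF mon[OF QU] gh] add[OF QU, of s t] W(7)[of Q] W'(7)[of Q] Q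
          add_fraction[OF mon[OF QU] W(4) W'(4) gh] by auto
    qed
    then show "\<exists>W m g. openin (zariski R M) W \<and> P \<in> W \<and> W \<subseteq> U \<and> m \<in> carrier M \<and> g \<in> carrier R \<and>
         (\<forall>Q \<in> W. g \<notin> colon R M Q \<and> (s \<oplus>\<^bsub>?O\<^esub> t) Q = fraction R M (carrier R - colon R M Q) m g)"
      using W W'
      by (intro exI[of _ "W \<inter> W'"] exI[of _ "h \<odot>\<^bsub>M\<^esub> m \<oplus>\<^bsub>M\<^esub> g \<odot>\<^bsub>M\<^esub> n"] exI[of _ "g \<otimes> h"]) auto
  qed
  have smult_closed: "r \<odot>\<^bsub>?O\<^esub> s \<in> sections R M U" if r: "r \<in> carrier R" and s: "s \<in> sections R M U" for r s
  proof (rule sectionsI)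
    show "r \<odot>\<^bsub>?O\<^esub> s \<in> extensional U" by (simp add: structure_sheaf_def)
    fix P assume P: "P \<in> U"
    obtain W m g where W: "openin (zariski R M) W" "P \<in> W" "W \<subseteq> U" "m \<in> carrier M" "g \<in> carrier R"
      "\<And>Q. Q \<in> W \<Longrightarrow> g \<notin> colon R M Q" "\<And>Q. Q \<in> W \<Longrightarrow> s Q = fraction R M (carrier R - colon R M Q) m g"
      using sectionsE[OF s P] by metis
    have "(r \<odot>\<^bsub>?O\<^esub> s) Q = fraction R M (carrier R - colon R M Q) (r \<odot>\<^bsub>M\<^esub> m) g" if Q: "Q \<in> W" for Q
    proof -
      have QU: "Q \<in> U" using Q W(3) by auto
      show ?thesis
        using smult[OF QU] W(7)[OF Q] smult_fraction[OF mon[OF QU] r W(4), of g] W(5) W(6)[OF Q] by simp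
    qed
    then show "\<exists>W m g. openin (zariski R M) W \<and> P \<in> W \<and> W \<subseteq> U \<and> m \<in> carrier M \<and> g \<in> carrier R \<and>
         (\<forall>Q \<in> W. g \<notin> colon R M Q \<and> (r \<odot>\<^bsub>?O\<^esub> s) Q = fraction R M (carrier R - colon R M Q) m g)"
      using W r by (intro exI[of _ W] exI[of _ "r \<odot>\<^bsub>M\<^esub> m"] exI[of _ g]) auto
  qed
  have st: "s P \<in> carrier (?L P)" if "s \<in> sections R M U" "P \<in> U" for s P
    using sections_stalk that by blast
  show ?thesis
  proof (rule moduleI)
    show "cring R" by (rule R.is_cring)
    show "abelian_group ?O"
    proof (rule abelian_groupI; unfold car)
      fix x y z assume "x \<in> sections R M U" "y \<in> sections R M U" "z \<in> sections R M U"
      then show "x \<oplus>\<^bsub>?O\<^esub> y \<oplus>\<^bsub>?O\<^esub> z = x \<oplus>\<^bsub>?O\<^esub> (y \<oplus>\<^bsub>?O\<^esub> z)"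
        using abelian_monoid.a_assoc[OF abelian_group.axioms(1)[OF grp]] st
        by (intro sections_ext[of _ U]) (auto simp: add add_closed)
    next
      fix x y assume "x \<in> sections R M U" "y \<in> sections R M U"
      then show "x \<oplus>\<^bsub>?O\<^esub> y = y \<oplus>\<^bsub>?O\<^esub> x"
        using abelian_monoid.a_comm[OF abelian_group.axioms(1)[OF grp]] st
        by (intro sections_ext[of _ U]) (auto simp: add add_closed)
    next
      fix x assume "x \<in> sections R M U"
      then show "\<zero>\<^bsub>?O\<^esub> \<oplus>\<^bsub>?O\<^esub> x = x"
        using abelian_monoid.l_zero[OF abelian_group.axioms(1)[OF grp]] st
        by (intro sections_ext[of _ U]) (auto simp: add zero zero_closed add_closed)
    next
      fix x assume x: "x \<in> sections R M U"
      have "(\<ominus> \<one>) \<odot>\<^bsub>?L P\<^esub> x P \<oplus>\<^bsub>?L P\<^esub> x P = \<zero>\<^bsub>?L P\<^esub>" if P: "P \<in> U" for P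
        using module.smult_l_minus[OF mod[OF P] R.one_closed st[OF x P]] st[OF x P]
          module.smult_one[OF mod[OF P]] abelian_group.l_neg[OF grp[OF P]] by simp
      then have "(\<ominus> \<one>) \<odot>\<^bsub>?O\<^esub> x \<oplus>\<^bsub>?O\<^esub> x = \<zero>\<^bsub>?O\<^esub>"
        using x by (intro sections_ext[of _ U]) (auto simp: add smult zero zero_closed add_closed smult_closed)
      then show "\<exists>y\<in>sections R M U. y \<oplus>\<^bsub>?O\<^esub> x = \<zero>\<^bsub>?O\<^esub>"
        using smult_closed[of "\<ominus> \<one>", OF _ x] by blast
    qed (simp_all add: zero_closed add_closed)
  next
    fix a x assume "a \<in> carrier R" "x \<in> carrier ?O"
    then show "a \<odot>\<^bsub>?O\<^esub> x \<in> carrier ?O" by (simp add: car smult_closed)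
  next
    fix a b x assume "a \<in> carrier R" "b \<in> carrier R" "x \<in> carrier ?O"
    then show "(a \<oplus> b) \<odot>\<^bsub>?O\<^esub> x = a \<odot>\<^bsub>?O\<^esub> x \<oplus>\<^bsub>?O\<^esub> b \<odot>\<^bsub>?O\<^esub> x"
      using module.smult_l_distr[OF mod] st unfolding car
      by (intro sections_ext[of _ U]) (auto simp: add smult add_closed smult_closed)
  next
    fix a x y assume "a \<in> carrier R" "x \<in> carrier ?O" "y \<in> carrier ?O"
    then show "a \<odot>\<^bsub>?O\<^esub> (x \<oplus>\<^bsub>?O\<^esub> y) = a \<odot>\<^bsub>?O\<^esub> x \<oplus>\<^bsub>?O\<^esub> a \<odot>\<^bsub>?O\<^esub> y"
      using module.smult_r_distr[OF mod] st unfolding car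
      by (intro sections_ext[of _ U]) (auto simp: add smult add_closed smult_closed)
  next
    fix a b x assume "a \<in> carrier R" "b \<in> carrier R" "x \<in> carrier ?O"
    then show "(a \<otimes> b) \<odot>\<^bsub>?O\<^esub> x = a \<odot>\<^bsub>?O\<^esub> (b \<odot>\<^bsub>?O\<^esub> x)"
      using module.smult_assoc1[OF mod] st unfolding car
      by (intro sections_ext[of _ U]) (auto simp: smult smult_closed)
  next
    fix x assume "x \<in> carrier ?O"
    then show "\<one> \<odot>\<^bsub>?O\<^esub> x = x"
      using module.smult_one[OF mod] st unfolding car
      by (intro sections_ext[of _ U]) (auto simp: smult smult_closed)
  qed
qed

end

end

theory Submission
  imports Defs "HOL-Algebra.Ring_Divisibility"
begin

text \<open>
  The classical proof for affine schemes only needs a criterion for radical membership: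
  if an ideal \<open>I\<close> contains \<open>Ann(M)\<close> and \<open>g\<close> lies in every \<open>(Q:M)\<close> that contains \<open>I\<close>, then a power
  of \<open>g\<close> lies in \<open>I\<close>. For a \<open>\<P>\<close>-radical module this holds although prime ideals containing
  \<open>Ann(M)\<close> need not be of the form \<open>(Q:M)\<close>: a prime ideal \<open>p\<close> that contains \<open>I\<close> and no power of \<open>g\<close> is
  the intersection of the ideals \<open>(Q:M)\<close> containing it, and \<open>g\<close> lies in all of them. Applied to the
  equaliser ideal of two elements, this yields injectivity of \<open>M\<^sub>f \<rightarrow> \<O>(D(fM))\<close>; applied to ideals of
  coefficients it yields quasi-compactness of \<open>D(fM)\<close> and the gluing of compatible local fractions.
\<close>

section \<open>Ideals avoiding a multiplicative set\<close>

context cring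
begin

lemma idealI_closed:
  assumes "I \<subseteq> carrier R" "\<zero> \<in> I"
    and add: "\<And>a b. a \<in> I \<Longrightarrow> b \<in> I \<Longrightarrow> a \<oplus> b \<in> I"
    and mult: "\<And>a x. a \<in> I \<Longrightarrow> x \<in> carrier R \<Longrightarrow> x \<otimes> a \<in> I"
  shows "ideal I R"
proof (rule idealI)
  show "ring R" by (rule ring_axioms)
  show "subgroup I (add_monoid R)"
  proof (rule add.subgroupI)
    fix a assume "a \<in> I"
    then have "(\<ominus> \<one>) \<otimes> a \<in> I" "a \<in> carrier R" using mult assms(1) by auto
    then show "\<ominus> a \<in> I" by (simp add: l_minus)
  qed (use assms in auto)
  fix a x assume a: "a \<in> I" "x \<in> carrier R"
  then show "x \<otimes> a \<in> I" by (rule mult)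
  then show "a \<otimes> x \<in> I" using a assms(1) by (metis m_comm subsetD)
qed

text \<open>Krull's argument: Zorn gives an ideal \<open>p\<close> maximal among those that contain
  \<open>I\<close> and miss \<open>S\<close>. If \<open>a\<close> and \<open>b\<close> are outside
  \<open>p\<close>, then \<open>p + (a)\<close> and \<open>p + (b)\<close> both meet
  \<open>S\<close>; with \<open>ab\<close> in \<open>p\<close>, the product of two such elements
  would lie in both \<open>S\<close> and \<open>p\<close>.\<close>

lemma primeideal_avoiding:
  assumes S: "submonoid S R" and I: "ideal I R" and IS: "I \<inter> S = {}"
  obtains p where "primeideal p R" "I \<subseteq> p" "p \<inter> S = {}"
proof -
  interpret S: submonoid S R by fact
  let ?A = "{J. ideal J R \<and> I \<subseteq> J \<and> J \<inter> S = {}}"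
  have "\<exists>p\<in>?A. \<forall>X\<in>?A. p \<subseteq> X \<longrightarrow> X = p"
  proof (rule subset_Zorn_nonempty)
    show "?A \<noteq> {}" using I IS by auto
    fix C assume C: "C \<noteq> {}" "subset.chain ?A C"
    then have "subset.chain {J. ideal J R} C" by (auto simp: pred_on.chain_def)
    from chain_Union_is_ideal[OF this] have "ideal (\<Union>C) R" using C(1) by simp
    moreover have "\<forall>J\<in>C. I \<subseteq> J \<and> J \<inter> S = {}" using C(2) by (auto simp: pred_on.chain_def)
    ultimately show "\<Union>C \<in> ?A" using C(1) by blast
  qed
  then obtain p where "p \<in> ?A" and A: "\<forall>X\<in>?A. p \<subseteq> X \<longrightarrow> X = p" by (elim bexE)
  then have p: "ideal p R" "I \<subseteq> p" "p \<inter> S = {}" by simp_all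
  have max: "J = p" if "ideal J R" "I \<subseteq> J" "J \<inter> S = {}" "p \<subseteq> J" for J
    using bspec[OF A, of J] that by simp
  interpret p: ideal p R by fact
  have meets: "\<exists>x\<in>p. \<exists>r\<in>carrier R. x \<oplus> r \<otimes> a \<in> S" if a: "a \<in> carrier R" "a \<notin> p" for a
  proof (rule ccontr)
    assume none: "\<not> ?thesis"
    let ?J = "p <+>\<^bsub>R\<^esub> PIdl a"
    have J: "?J = {x \<oplus> r \<otimes> a | x r. x \<in> p \<and> r \<in> carrier R}"
      by (auto simp: set_add_def' cgenideal_def)
    have mem: "x \<oplus> r \<otimes> a \<in> ?J" if "x \<in> p" "r \<in> carrier R" for x r
      unfolding J using that by blast
    have ideal: "ideal ?J R" by (intro add_ideals p(1) cgenideal_ideal a(1))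
    have sub: "p \<subseteq> ?J" using mem[of _ \<zero>] a(1) p.Icarr by auto
    have "a \<in> ?J" using mem[of \<zero> \<one>] a(1) by simp
    moreover have "?J \<inter> S = {}" using none unfolding J by blast
    ultimately show False using max[OF ideal _ _ sub] sub p(2) a(2) by blast
  qed
  have "primeideal p R"
  proof (rule primeidealI[OF p(1) is_cring])
    show "carrier R \<noteq> p" using p(3) S.one_closed by auto
    fix a b assume ab: "a \<in> carrier R" "b \<in> carrier R" "a \<otimes> b \<in> p"
    show "a \<in> p \<or> b \<in> p"
    proof (rule ccontr)
      assume "\<not> ?thesis"
      then obtain x r y t where xr: "x \<in> p" "r \<in> carrier R" "x \<oplus> r \<otimes> a \<in> S"
        and yt: "y \<in> p" "t \<in> carrier R" "y \<oplus> t \<otimes> b \<in> S"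
        using meets ab by metis
      have xy: "x \<in> carrier R" "y \<in> carrier R" using xr(1) yt(1) p.Icarr by auto
      \<comment> \<open>The terms are grouped so that each visibly has a factor in \<open>p\<close>:
        \<open>x\<close>, \<open>y\<close> and \<open>a \<otimes> b\<close> respectively.\<close>
      have "(x \<oplus> r \<otimes> a) \<otimes> (y \<oplus> t \<otimes> b) = (y \<oplus> t \<otimes> b) \<otimes> x \<oplus> (r \<otimes> a \<otimes> y \<oplus> r \<otimes> t \<otimes> (a \<otimes> b))"
        using xy xr(2) yt(2) ab(1,2) by (simp add: l_distr r_distr m_ac a_ac)
      moreover have "\<dots> \<in> p"
        using xy xr(2) yt(2) ab(1,2)
        by (intro p.a_closed p.I_l_closed[OF xr(1)] p.I_l_closed[OF yt(1)] p.I_l_closed[OF ab(3)]) simp_all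
      ultimately show False using S.m_closed[OF xr(3) yt(3)] p(3) by auto
    qed
  qed
  then show thesis using that p(2,3) by blast
qed

end

section \<open>Module isomorphisms\<close>

lemma module_isomorphic_trans:
  assumes "module_isomorphic R A B" "module_isomorphic R B C"
  shows "module_isomorphic R A C"
proof -
  obtain g h where g: "g \<in> module_hom R A B" "bij_betw g (carrier A) (carrier B)"
    and h: "h \<in> module_hom R B C" "bij_betw h (carrier B) (carrier C)"
    using assms by (auto simp: module_isomorphic_def)
  have "h \<circ> g \<in> module_hom R A C"
    using g(1) h(1) by (auto simp: module_hom_def Pi_iff)
  then show ?thesis
    unfolding module_isomorphic_def using bij_betw_trans[OF g(2) h(2)] by blast
qed

text \<open>The module axioms of \<open>A\<close> keep sums and multiples of preimages inside
  \<open>carrier A\<close>, where the inverse function cancels \<open>h\<close>.\<close>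

lemma module_isomorphic_sym:
  assumes A: "module R A" and "module_isomorphic R A B"
  shows "module_isomorphic R B A"
proof -
  interpret A: module R A by fact
  obtain h where hom: "h \<in> module_hom R A B" and bij: "bij_betw h (carrier A) (carrier B)"
    using assms by (auto simp: module_isomorphic_def)
  let ?g = "inv_into (carrier A) h"
  have bij': "bij_betw ?g (carrier B) (carrier A)" by (rule bij_betw_inv_into[OF bij])
  have gc: "?g x \<in> carrier A" if "x \<in> carrier B" for x using bij' that by (rule bij_betwE[THEN bspec])
  have hg: "h (?g x) = x" if "x \<in> carrier B" for x using bij_betw_inv_into_right[OF bij that] .
  have gh: "?g (h x) = x" if "x \<in> carrier A" for x using bij_betw_inv_into_left[OF bij that] .
  have "?g \<in> module_hom R B A"
    unfolding module_hom_def
  proof (intro CollectI conjI ballI)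
    show "?g \<in> carrier B \<rightarrow> carrier A" using gc by auto
    fix x assume x: "x \<in> carrier B"
    show "?g (x \<oplus>\<^bsub>B\<^esub> y) = ?g x \<oplus>\<^bsub>A\<^esub> ?g y" if y: "y \<in> carrier B" for y
    proof -
      have "h (?g x \<oplus>\<^bsub>A\<^esub> ?g y) = x \<oplus>\<^bsub>B\<^esub> y"
        using hom x y by (simp add: module_hom_def gc hg)
      then show ?thesis using gh[OF A.M.add.m_closed[OF gc[OF x] gc[OF y]]] by simp
    qed
  next
    fix r x assume r: "r \<in> carrier R" and x: "x \<in> carrier B"
    have "h (r \<odot>\<^bsub>A\<^esub> ?g x) = r \<odot>\<^bsub>B\<^esub> x"
      using hom x r by (simp add: module_hom_def gc hg)
    then show "?g (r \<odot>\<^bsub>B\<^esub> x) = r \<odot>\<^bsub>A\<^esub> ?g x"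
      using gh[OF A.smult_closed[OF r gc[OF x]]] by simp
  qed
  with bij' show ?thesis unfolding module_isomorphic_def by blast
qed

section \<open>Basic open sets\<close>

context module
begin

abbreviation stalk_fraction :: "'c set \<Rightarrow> 'c \<Rightarrow> 'a \<Rightarrow> ('c \<times> 'a) set"
  where "stalk_fraction P \<equiv> fraction R M (carrier R - colon R M P)"

lemma colon_primeideal: "Q \<in> Spec R M \<Longrightarrow> primeideal (colon R M Q) R"
  by (simp add: Spec_def prime_colon)

lemma annihilator_smult: "r \<in> annihilator R M \<Longrightarrow> x \<in> carrier M \<Longrightarrow> r \<odot>\<^bsub>M\<^esub> x = \<zero>\<^bsub>M\<^esub>"
  by (simp add: annihilator_def colon_def)

lemma annihilator_carrier: "annihilator R M \<subseteq> carrier R"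
  by (auto simp: annihilator_def colon_def)

lemma annihilator_subset_colon: "Q \<in> Spec R M \<Longrightarrow> annihilator R M \<subseteq> colon R M Q"
  using subgroup.one_closed[OF submodule.axioms(1), of Q]
  by (auto simp: annihilator_def colon_def Spec_def prime_submodule_def)

lemma in_basic_open:
  "f \<in> carrier R \<Longrightarrow> Q \<in> basic_open R M f \<longleftrightarrow> Q \<in> Spec R M \<and> f \<notin> colon R M Q"
  by (simp add: basic_open_eq)

lemma basic_open_one: "basic_open R M \<one> = Spec R M"
proof -
  have "\<one> \<notin> colon R M Q" if "Q \<in> Spec R M" for Q
    using submonoid.one_closed[OF submonoid_colon[OF that]] by simp
  then show ?thesis by (auto simp: in_basic_open)
qed

lemma basic_open_mult:
  assumes "f \<in> carrier R" "g \<in> carrier R"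
  shows "basic_open R M (f \<otimes> g) = basic_open R M f \<inter> basic_open R M g"
proof -
  have "f \<otimes> g \<in> colon R M Q \<longleftrightarrow> f \<in> colon R M Q \<or> g \<in> colon R M Q" if "Q \<in> Spec R M" for Q
  proof -
    interpret Q: primeideal "colon R M Q" R using that by (rule colon_primeideal)
    show ?thesis using assms Q.I_prime Q.I_l_closed Q.I_r_closed by blast
  qed
  then show ?thesis using assms by (auto simp: in_basic_open)
qed

lemma pow_notin_colon:
  assumes "Q \<in> basic_open R M f" "f \<in> carrier R"
  shows "f [^] (n::nat) \<notin> colon R M Q"
proof (induction n)
  case 0
  have "Q \<in> basic_open R M \<one>" using assms by (simp add: basic_open_one in_basic_open)
  then show ?case using in_basic_open[OF R.one_closed, of Q] by simp
next
  case (Suc n)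
  then have "Q \<in> basic_open R M (f [^] n)" using assms by (simp add: in_basic_open)
  then have "Q \<in> basic_open R M (f [^] Suc n)" using assms basic_open_mult[of "f [^] n" f] by simp
  then show ?case using assms in_basic_open[of "f [^] Suc n" Q] by blast
qed

lemma basic_open_pow_Suc:
  assumes "f \<in> carrier R" shows "basic_open R M (f [^] Suc n) = basic_open R M f"
  using pow_notin_colon[of _ f n] assms basic_open_mult[of "f [^] n" f] by (auto simp: in_basic_open)

section \<open>Radical membership in \<open>\<P>\<close>-radical modules\<close>

lemma P_radical_power_mem:
  assumes rad: "P_radical R M" and I: "ideal I R" and ann: "annihilator R M \<subseteq> I"
    and g: "g \<in> carrier R"
    and mem: "\<And>Q. Q \<in> Spec R M \<Longrightarrow> I \<subseteq> colon R M Q \<Longrightarrow> g \<in> colon R M Q"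
  obtains n :: nat where "g [^] n \<in> I"
proof -
  have "I \<inter> powers R g \<noteq> {}"
  proof
    assume "I \<inter> powers R g = {}"
    then obtain p where p: "primeideal p R" "I \<subseteq> p" "p \<inter> powers R g = {}"
      using R.primeideal_avoiding[OF submonoid_powers[OF g] I] by metis
    let ?N = "ideal_times R M p"
    have pc: "p \<subseteq> carrier R" using p(1) by (meson ideal.Icarr primeideal_def subsetI)
    \<comment> \<open>A prime submodule \<open>Q\<close> that contains \<open>pM\<close> satisfies
      \<open>I \<subseteq> p \<subseteq> (Q:M)\<close>, so \<open>mem\<close> applies to it.\<close>
    have "p \<subseteq> colon R M Q" if Q: "?N \<subseteq> Q" for Q
    proof -
      have "a \<odot>\<^bsub>M\<^esub> m \<in> ?N" if "a \<in> p" "m \<in> carrier M" for a m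
        using that by (auto simp: ideal_times_def submodule_generated_def)
      then show ?thesis using Q pc by (auto simp: colon_def)
    qed
    then have "g \<in> colon R M Q" if "Q \<in> Spec R M" "?N \<subseteq> Q" for Q
      using mem that p(2) by blast
    \<comment> \<open>\<open>gM\<close> lies in every such \<open>Q\<close>, hence in their
      intersection; if there is no such \<open>Q\<close>, the radical is all of \<open>M\<close> and
      the claim is trivial.\<close>
    then have "g \<in> colon R M (prime_radical R M ?N)"
      using g by (auto simp: colon_def prime_radical_def)
    \<comment> \<open>Here the radical hypothesis enters: \<open>p\<close> contains
      \<open>Ann(M)\<close> because \<open>I\<close> does, so this colon ideal is \<open>p\<close>
      itself.\<close>
    then have "g \<in> p" using rad p(1,2) ann by (auto simp: P_radical_def)
    moreover have "g \<in> powers R g"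
      using g unfolding powers_def by (auto intro!: exI[of _ "1::nat"])
    ultimately show False using p(3) by blast
  qed
  then obtain n :: nat where "g [^] n \<in> I" unfolding powers_def by blast
  then show thesis by (rule that)
qed

text \<open>For \<open>Q\<close> in \<open>D(fM)\<close> the given \<open>u\<close> lies in the
  equaliser ideal but not in (Q:M). Hence any (Q:M) that contains this ideal must contain
  \<open>f\<close>.\<close>

lemma eq_on_basic_open:
  assumes rad: "P_radical R M" and f: "f \<in> carrier R" and x: "x \<in> carrier M" and y: "y \<in> carrier M"
    and eq: "\<And>Q. Q \<in> basic_open R M f \<Longrightarrow> \<exists>u \<in> carrier R - colon R M Q. u \<odot>\<^bsub>M\<^esub> x = u \<odot>\<^bsub>M\<^esub> y"
  obtains n :: nat where "f [^] n \<odot>\<^bsub>M\<^esub> x = f [^] n \<odot>\<^bsub>M\<^esub> y"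
proof -
  let ?I = "{r \<in> carrier R. r \<odot>\<^bsub>M\<^esub> x = r \<odot>\<^bsub>M\<^esub> y}"
  have "ideal ?I R"
    using x y by (intro R.idealI_closed) (auto simp: smult_l_distr smult_assoc1)
  moreover have "annihilator R M \<subseteq> ?I"
    using x y annihilator_smult annihilator_carrier by auto
  moreover have "f \<in> colon R M Q" if "Q \<in> Spec R M" "?I \<subseteq> colon R M Q" for Q
    using eq[of Q] that f by (auto simp: in_basic_open)
  ultimately obtain n :: nat where "f [^] n \<in> ?I"
    by (rule P_radical_power_mem[OF rad _ _ f])
  then show thesis using that by auto
qed

lemma basic_open_finite_subcover:
  assumes rad: "P_radical R M" and f: "f \<in> carrier R" and C: "C \<subseteq> carrier R"
    and cover: "basic_open R M f \<subseteq> (\<Union>c\<in>C. basic_open R M c)"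
  obtains F where "finite F" "F \<subseteq> C" "basic_open R M f \<subseteq> (\<Union>c\<in>F. basic_open R M c)"
proof -
  let ?G = "\<lambda>F. Idl (F \<union> annihilator R M)"
  \<comment> \<open>This is the ideal generated by \<open>C\<close> and \<open>Ann(M)\<close>,
    written as a directed union over finite subsets of \<open>C\<close>, so that membership of a
    power of \<open>f\<close> directly supplies the finite subfamily.\<close>
  let ?I = "{r. \<exists>F. finite F \<and> F \<subseteq> C \<and> r \<in> ?G F}"
  have sub: "F \<union> annihilator R M \<subseteq> carrier R" if "F \<subseteq> C" for F
    using that C annihilator_carrier by auto
  have id: "ideal (?G F) R" if "F \<subseteq> C" for F using sub[OF that] by (rule R.genideal_ideal)
  have self: "F \<union> annihilator R M \<subseteq> ?G F" if "F \<subseteq> C" for F using sub[OF that] by (rule R.genideal_self)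
  have mono: "?G F \<subseteq> ?G F'" if "F \<subseteq> F'" for F F'
    using that by (auto simp: genideal_def)
  have CI: "C \<subseteq> ?I"
  proof
    fix c assume "c \<in> C"
    then show "c \<in> ?I" using self[of "{c}"] by (auto intro!: exI[of _ "{c}"])
  qed
  have "ideal ?I R"
  proof (rule R.idealI_closed)
    show "?I \<subseteq> carrier R"
    proof clarify
      fix r F assume "F \<subseteq> C" "r \<in> ?G F"
      then show "r \<in> carrier R" using ideal.Icarr[OF id] by simp
    qed
    show "\<zero> \<in> ?I"
      using additive_subgroup.zero_closed[OF ideal.axioms(1)[OF id[of "{}"]]]
      by (intro CollectI exI[of _ "{}"]) simp
    fix a assume "a \<in> ?I"
    then obtain F where F: "finite F" "F \<subseteq> C" "a \<in> ?G F" by blast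
    show "x \<otimes> a \<in> ?I" if "x \<in> carrier R" for x
      using F ideal.I_l_closed[OF id[OF F(2)] F(3) that] by blast
    fix b assume "b \<in> ?I"
    then obtain F' where F': "finite F'" "F' \<subseteq> C" "b \<in> ?G F'" by blast
    have FF: "F \<union> F' \<subseteq> C" using F F' by simp
    have "a \<in> ?G (F \<union> F')" "b \<in> ?G (F \<union> F')"
      using mono[of F "F \<union> F'"] mono[of F' "F \<union> F'"] F(3) F'(3) by auto
    then have "a \<oplus> b \<in> ?G (F \<union> F')"
      using additive_subgroup.a_closed[OF ideal.axioms(1)[OF id[OF FF]]] by blast
    then show "a \<oplus> b \<in> ?I" using F(1) F'(1) FF by blast
  qed
  moreover have "annihilator R M \<subseteq> ?I" using self[of "{}"] by blast
  moreover have "f \<in> colon R M Q" if Q: "Q \<in> Spec R M" "?I \<subseteq> colon R M Q" for Q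
  proof (rule ccontr)
    assume "f \<notin> colon R M Q"
    then obtain c where "c \<in> C" "Q \<in> basic_open R M c" using cover Q(1) f in_basic_open by blast
    then show False using CI Q C in_basic_open by blast
  qed
  ultimately obtain n :: nat where "f [^] n \<in> ?I"
    by (rule P_radical_power_mem[OF rad _ _ f])
  then obtain F where F: "finite F" "F \<subseteq> C" "f [^] n \<in> ?G F" by blast
  have "basic_open R M f \<subseteq> (\<Union>c\<in>F. basic_open R M c)"
  proof
    fix Q assume Q: "Q \<in> basic_open R M f"
    then have QS: "Q \<in> Spec R M" using f in_basic_open by blast
    show "Q \<in> (\<Union>c\<in>F. basic_open R M c)"
    proof (rule ccontr)
      assume "\<not> ?thesis"
      \<comment> \<open>If \<open>Q\<close> were outside every \<open>D(cM)\<close> with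
        \<open>c\<close> in \<open>F\<close>, then (Q:M) would contain all generators of
        \<open>?G F\<close>, hence the power of \<open>f\<close>.\<close>
      then have "F \<subseteq> colon R M Q" using in_basic_open QS F(2) C by blast
      then have "?G F \<subseteq> colon R M Q"
        using annihilator_subset_colon[OF QS] primeideal.axioms(1)[OF colon_primeideal[OF QS]]
        by (intro R.genideal_minimal) auto
      then show False using F(3) pow_notin_colon[OF Q f] by blast
    qed
  qed
  then show thesis using that F by blast
qed

section \<open>Sections over basic open sets\<close>

text \<open>If \<open>W\<close> is the complement of \<open>V(N)\<close>, any \<open>a\<close> in
  (N:M) outside (P:M) works, since a prime submodule in \<open>V(N)\<close> has \<open>a\<close> in
  its colon ideal.\<close>

lemma openin_contains_basic_open:
  assumes "openin (zariski R M) W" "P \<in> W"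
  obtains a where "a \<in> carrier R" "P \<in> basic_open R M a" "basic_open R M a \<subseteq> W"
proof -
  obtain N where N: "W = Spec R M - V R M N"
    using assms(1) by (auto simp: openin_zariski)
  with assms(2) have PS: "P \<in> Spec R M" "\<not> colon R M N \<subseteq> colon R M P" by (auto simp: V_def)
  then obtain a where a: "a \<in> colon R M N" "a \<notin> colon R M P" by blast
  have ac: "a \<in> carrier R" using a(1) by (simp add: colon_def)
  show thesis
  proof (rule that[OF ac])
    show "P \<in> basic_open R M a" using a(2) PS(1) in_basic_open[OF ac] by simp
    show "basic_open R M a \<subseteq> W" using a(1) in_basic_open[OF ac] unfolding N V_def by blast
  qed
qed

text \<open>The local form is normalised so that the denominator also cuts out the neighbourhood. On
  a basic open set \<open>D(aM)\<close> inside \<open>W\<close> the function \<open>g\<close> does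
  not vanish, so \<open>D(agM) = D(aM)\<close>, and \<open>m/g\<close> is rewritten as
  \<open>am/(ag)\<close>.\<close>

lemma sections_basic_open:
  assumes s: "s \<in> sections R M U" and P: "P \<in> U"
  obtains x c where "x \<in> carrier M" "c \<in> carrier R" "P \<in> basic_open R M c" "basic_open R M c \<subseteq> U"
    "\<And>Q. Q \<in> basic_open R M c \<Longrightarrow> s Q = stalk_fraction Q x c"
proof -
  obtain W m g where W: "openin (zariski R M) W" "P \<in> W" "W \<subseteq> U" "m \<in> carrier M" "g \<in> carrier R"
    "\<And>Q. Q \<in> W \<Longrightarrow> g \<notin> colon R M Q" "\<And>Q. Q \<in> W \<Longrightarrow> s Q = stalk_fraction Q m g"
    using sectionsE[OF s P] by metis
  obtain a where a: "a \<in> carrier R" "P \<in> basic_open R M a" "basic_open R M a \<subseteq> W"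
    using openin_contains_basic_open[OF W(1,2)] .
  have sub: "basic_open R M a \<subseteq> basic_open R M g"
    using a(1,3) W(5,6) by (auto simp: in_basic_open)
  then have eq: "basic_open R M (a \<otimes> g) = basic_open R M a"
    using basic_open_mult[OF a(1) W(5)] by auto
  show thesis
  proof (rule that)
    show "a \<odot>\<^bsub>M\<^esub> m \<in> carrier M" "a \<otimes> g \<in> carrier R" using a(1) W(4,5) by auto
    show "P \<in> basic_open R M (a \<otimes> g)" "basic_open R M (a \<otimes> g) \<subseteq> U" using eq a W(3) by auto
    fix Q assume Q: "Q \<in> basic_open R M (a \<otimes> g)"
    then have QS: "Q \<in> Spec R M" and ag: "a \<otimes> g \<notin> colon R M Q"
      using a(1) W(5) by (simp_all add: in_basic_open)
    have QW: "Q \<in> W" using Q eq a(3) by auto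
    have "stalk_fraction Q m g = stalk_fraction Q (a \<odot>\<^bsub>M\<^esub> m) (a \<otimes> g)"
      using W(4,5) W(6)[OF QW] a(1) ag submonoid.one_closed[OF submonoid_colon[OF QS]]
      by (subst fraction_eq_iff[OF submonoid_colon[OF QS]])
        (auto intro!: bexI[of _ \<one>] simp: smult_assoc1 smult_left_commute[of g a])
    then show "s Q = stalk_fraction Q (a \<odot>\<^bsub>M\<^esub> m) (a \<otimes> g)" using W(7)[OF QW] by simp
  qed
qed

text \<open>The ideal of all \<open>r\<close> such that the family of all \<open>r x / c\<close> comes from one element of \<open>M\<close>
  contains every denominator \<open>c\<close>, by compatibility; no finite sums are needed.\<close>
lemma glue_fractions:
  assumes rad: "P_radical R M" and f: "f \<in> carrier R" and F: "F \<subseteq> carrier M \<times> carrier R"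
    and cover: "basic_open R M f \<subseteq> (\<Union>(x, c)\<in>F. basic_open R M c)"
    and compat: "\<And>x c y d. (x, c) \<in> F \<Longrightarrow> (y, d) \<in> F \<Longrightarrow> d \<odot>\<^bsub>M\<^esub> x = c \<odot>\<^bsub>M\<^esub> y"
  obtains m and n :: nat where "m \<in> carrier M"
    "\<forall>(x, c) \<in> F. c \<odot>\<^bsub>M\<^esub> m = f [^] n \<odot>\<^bsub>M\<^esub> x"
proof -
  let ?I = "{r \<in> carrier R. \<exists>m \<in> carrier M. \<forall>(x, c) \<in> F. c \<odot>\<^bsub>M\<^esub> m = r \<odot>\<^bsub>M\<^esub> x}"
  have FM: "x \<in> carrier M" "c \<in> carrier R" if "(x, c) \<in> F" for x c using that F by auto
  have "ideal ?I R"
  proof (rule R.idealI_closed)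
    show "\<zero> \<in> ?I" using FM by (auto intro!: bexI[of _ "\<zero>\<^bsub>M\<^esub>"])
    fix a assume "a \<in> ?I"
    then obtain m where a: "a \<in> carrier R" and m: "m \<in> carrier M"
      "\<And>x c. (x, c) \<in> F \<Longrightarrow> c \<odot>\<^bsub>M\<^esub> m = a \<odot>\<^bsub>M\<^esub> x" by blast
    have "c \<odot>\<^bsub>M\<^esub> (r \<odot>\<^bsub>M\<^esub> m) = (r \<otimes> a) \<odot>\<^bsub>M\<^esub> x" if "r \<in> carrier R" "(x, c) \<in> F" for r x c
      using m that a FM[of x c] by (simp add: smult_assoc1 smult_left_commute[of c r])
    then show "r \<otimes> a \<in> ?I" if "r \<in> carrier R" for r
      using a m(1) that by (auto intro!: bexI[of _ "r \<odot>\<^bsub>M\<^esub> m"])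
    fix b assume "b \<in> ?I"
    then obtain k where b: "b \<in> carrier R" and k: "k \<in> carrier M"
      "\<And>x c. (x, c) \<in> F \<Longrightarrow> c \<odot>\<^bsub>M\<^esub> k = b \<odot>\<^bsub>M\<^esub> x" by blast
    have "c \<odot>\<^bsub>M\<^esub> (m \<oplus>\<^bsub>M\<^esub> k) = (a \<oplus> b) \<odot>\<^bsub>M\<^esub> x" if "(x, c) \<in> F" for x c
      using m k that a b FM[of x c] by (simp add: smult_l_distr smult_r_distr)
    then show "a \<oplus> b \<in> ?I"
      using a b m(1) k(1) by (auto intro!: bexI[of _ "m \<oplus>\<^bsub>M\<^esub> k"])
  qed auto
  moreover have "annihilator R M \<subseteq> ?I"
    using annihilator_carrier FM by (auto intro!: bexI[of _ "\<zero>\<^bsub>M\<^esub>"] simp: annihilator_smult)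
  moreover have "f \<in> colon R M Q" if Q: "Q \<in> Spec R M" "?I \<subseteq> colon R M Q" for Q
  proof (rule ccontr)
    assume "f \<notin> colon R M Q"
    then obtain x c where xc: "(x, c) \<in> F" "Q \<in> basic_open R M c"
      using cover Q(1) f in_basic_open by blast
    \<comment> \<open>The witness for \<open>c\<close> is its own numerator \<open>x\<close>:
      compatibility with a pair \<open>(y, d)\<close> says exactly \<open>d x = c y\<close>.\<close>
    then have "c \<in> ?I" using FM[OF xc(1)] compat by (auto intro!: bexI[of _ x])
    then show False using xc(2) Q(2) by (auto simp: in_basic_open)
  qed
  ultimately obtain n :: nat where "f [^] n \<in> ?I"
    by (rule P_radical_power_mem[OF rad _ _ f])
  then show thesis using that by blast
qed

text \<open>Finitely many fractions \<open>x/c\<close> represent \<open>s\<close>. Two of them agree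
  on \<open>D(cdM)\<close>, so \<open>d x\<close> and \<open>c y\<close> agree up to a power of
  \<open>cd\<close>. A common exponent absorbs these powers into the fractions, which are then
  strictly compatible and can be glued.\<close>

lemma section_eq_fraction:
  assumes rad: "P_radical R M" and f: "f \<in> carrier R" and s: "s \<in> sections R M (basic_open R M f)"
  obtains m t where "m \<in> carrier M" "t \<in> powers R f"
    "\<forall>Q \<in> basic_open R M f. s Q = stalk_fraction Q m t"
proof -
  let ?D = "basic_open R M"
  let ?T = "{(x, c). x \<in> carrier M \<and> c \<in> carrier R \<and> ?D c \<subseteq> ?D f \<and> (\<forall>Q \<in> ?D c. s Q = stalk_fraction Q x c)}"
  have cover: "?D f \<subseteq> (\<Union>c \<in> snd ` ?T. ?D c)"
  proof
    fix P assume "P \<in> ?D f"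
    then obtain x c where "x \<in> carrier M" "c \<in> carrier R" "P \<in> ?D c" "?D c \<subseteq> ?D f"
      "\<And>Q. Q \<in> ?D c \<Longrightarrow> s Q = stalk_fraction Q x c"
      using sections_basic_open[OF s] by metis
    then have "(x, c) \<in> ?T" "P \<in> ?D (snd (x, c))" by auto
    then show "P \<in> (\<Union>c \<in> snd ` ?T. ?D c)" by blast
  qed
  have TR: "snd ` ?T \<subseteq> carrier R" by auto
  obtain C where C: "finite C" "C \<subseteq> snd ` ?T" "?D f \<subseteq> (\<Union>c\<in>C. ?D c)"
    by (rule basic_open_finite_subcover[OF rad f TR cover])
  \<comment> \<open>The subcover only selects denominators; this chooses a numerator for each of
    them while keeping the family finite.\<close>
  obtain F where F: "F \<subseteq> ?T" "finite F" "C = snd ` F"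
    using finite_subset_image[OF C(1,2)] by blast
  have FT: "x \<in> carrier M" "c \<in> carrier R" "?D c \<subseteq> ?D f" if "(x, c) \<in> F" for x c
    using that F(1) by auto
  have Fs: "s Q = stalk_fraction Q x c" if "(x, c) \<in> F" "Q \<in> ?D c" for x c Q
    using that F(1) by auto
  have pair: "\<exists>k::nat. (c \<otimes> d) [^] k \<odot>\<^bsub>M\<^esub> (d \<odot>\<^bsub>M\<^esub> x) = (c \<otimes> d) [^] k \<odot>\<^bsub>M\<^esub> (c \<odot>\<^bsub>M\<^esub> y)"
    if xc: "(x, c) \<in> F" and yd: "(y, d) \<in> F" for x c y d
  proof -
    note xc' = FT[OF xc] and yd' = FT[OF yd]
    have "\<exists>u \<in> carrier R - colon R M Q. u \<odot>\<^bsub>M\<^esub> (d \<odot>\<^bsub>M\<^esub> x) = u \<odot>\<^bsub>M\<^esub> (c \<odot>\<^bsub>M\<^esub> y)"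
      if "Q \<in> ?D (c \<otimes> d)" for Q
    proof -
      have Q: "Q \<in> ?D c" "Q \<in> ?D d" using that basic_open_mult xc' yd' by auto
      then have QS: "Q \<in> Spec R M" and n: "c \<notin> colon R M Q" "d \<notin> colon R M Q"
        using in_basic_open xc' yd' by auto
      have "stalk_fraction Q x c = stalk_fraction Q y d" using Fs[OF xc] Fs[OF yd] Q by metis
      then show ?thesis
        using fraction_eq_iff[OF submonoid_colon[OF QS], of x c y d] xc' yd' n by auto
    qed
    then show ?thesis
      using eq_on_basic_open[OF rad, of "c \<otimes> d" "d \<odot>\<^bsub>M\<^esub> x" "c \<odot>\<^bsub>M\<^esub> y"] xc' yd' by blast
  qed
  \<comment> \<open>One exponent is chosen for each pair; the maximum \<open>N\<close> over the
    finite set \<open>F \<times> F\<close> serves all pairs, since the equation survives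
    multiplication by further powers.\<close>
  define k where "k = (\<lambda>((x, c), (y, d)). SOME k::nat.
      (c \<otimes> d) [^] k \<odot>\<^bsub>M\<^esub> (d \<odot>\<^bsub>M\<^esub> x) = (c \<otimes> d) [^] k \<odot>\<^bsub>M\<^esub> (c \<odot>\<^bsub>M\<^esub> y))"
  define N where "N = Max (k ` (F \<times> F))"
  have uniform: "(c \<otimes> d) [^] N \<odot>\<^bsub>M\<^esub> (d \<odot>\<^bsub>M\<^esub> x) = (c \<otimes> d) [^] N \<odot>\<^bsub>M\<^esub> (c \<odot>\<^bsub>M\<^esub> y)"
    if xc: "(x, c) \<in> F" and yd: "(y, d) \<in> F" for x c y d
  proof -
    note cl = FT(1,2)[OF xc] FT(1,2)[OF yd]
    let ?k = "k ((x, c), (y, d))"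
    have "?k \<le> N" unfolding N_def using xc yd F(2) by (intro Max_ge) auto
    then have N: "(c \<otimes> d) [^] N = (c \<otimes> d) [^] (N - ?k) \<otimes> (c \<otimes> d) [^] ?k"
      using cl by (simp add: R.nat_pow_mult)
    have "(c \<otimes> d) [^] ?k \<odot>\<^bsub>M\<^esub> (d \<odot>\<^bsub>M\<^esub> x) = (c \<otimes> d) [^] ?k \<odot>\<^bsub>M\<^esub> (c \<odot>\<^bsub>M\<^esub> y)"
      unfolding k_def prod.case using pair[OF xc yd] by (rule someI_ex)
    then show ?thesis unfolding N using cl by (simp add: smult_assoc1 del: R.nat_pow_distrib)
  qed
  \<comment> \<open>Each \<open>x/c\<close> is expanded by \<open>c^N\<close>. This changes neither
    the fraction nor its basic open set, and by \<open>pow_swap\<close> strict compatibility of the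
    new pairs is precisely \<open>uniform\<close>.\<close>
  let ?F = "(\<lambda>(x, c). (c [^] N \<odot>\<^bsub>M\<^esub> x, c [^] Suc N)) ` F"
  have pow_swap: "d [^] Suc N \<odot>\<^bsub>M\<^esub> (c [^] N \<odot>\<^bsub>M\<^esub> x) = (c \<otimes> d) [^] N \<odot>\<^bsub>M\<^esub> (d \<odot>\<^bsub>M\<^esub> x)"
    if "c \<in> carrier R" "d \<in> carrier R" "x \<in> carrier M" for c d x
  proof -
    have "d [^] Suc N \<otimes> c [^] N = (c \<otimes> d) [^] N \<otimes> d"
      using that by (simp add: R.nat_pow_distrib R.m_ac)
    then show ?thesis using that smult_assoc1 by (metis R.nat_pow_closed R.m_closed)
  qed
  have "?F \<subseteq> carrier M \<times> carrier R" using FT by auto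
  moreover have "?D f \<subseteq> (\<Union>(x, c)\<in>?F. ?D c)"
  proof
    fix Q assume "Q \<in> ?D f"
    then obtain x c where xc: "(x, c) \<in> F" "Q \<in> ?D c" using C(3) F(3) by auto
    then have "Q \<in> ?D (c [^] Suc N)" using basic_open_pow_Suc[OF FT(2)[OF xc(1)]] by blast
    then show "Q \<in> (\<Union>(x, c)\<in>?F. ?D c)" using xc(1) by force
  qed
  moreover have "d \<odot>\<^bsub>M\<^esub> x = c \<odot>\<^bsub>M\<^esub> y" if xc: "(x, c) \<in> ?F" and yd: "(y, d) \<in> ?F" for x c y d
  proof -
    obtain x' c' y' d' where F': "(x', c') \<in> F" "(y', d') \<in> F"
      and eqs: "x = c' [^] N \<odot>\<^bsub>M\<^esub> x'" "c = c' [^] Suc N" "y = d' [^] N \<odot>\<^bsub>M\<^esub> y'" "d = d' [^] Suc N"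
      using xc yd by (elim imageE) auto
    note cl = FT(1,2)[OF F'(1)] FT(1,2)[OF F'(2)]
    show ?thesis
      unfolding eqs using uniform[OF F'] pow_swap[of c' d' x'] pow_swap[of d' c' y'] cl
      by (simp add: R.m_comm[of d' c'])
  qed
  ultimately obtain m and n :: nat where m: "m \<in> carrier M"
    and n: "\<forall>(x, c) \<in> ?F. c \<odot>\<^bsub>M\<^esub> m = f [^] n \<odot>\<^bsub>M\<^esub> x"
    by (rule glue_fractions[OF rad f])
  have "s Q = stalk_fraction Q m (f [^] n)" if Q: "Q \<in> ?D f" for Q
  proof -
    obtain x c where xc: "(x, c) \<in> F" "Q \<in> ?D c" using Q C(3) F(3) by auto
    note cl = FT(1,2)[OF xc(1)]
    have QS: "Q \<in> Spec R M" and nc: "c \<notin> colon R M Q" using xc(2) cl in_basic_open by auto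
    have "c [^] Suc N \<odot>\<^bsub>M\<^esub> m = f [^] n \<odot>\<^bsub>M\<^esub> (c [^] N \<odot>\<^bsub>M\<^esub> x)"
      using n xc(1) by auto
    \<comment> \<open>The factor \<open>c^N\<close> is outside (Q:M), so it witnesses
      \<open>x/c = m/f^n\<close> in the stalk.\<close>
    then have "c [^] N \<odot>\<^bsub>M\<^esub> (f [^] n \<odot>\<^bsub>M\<^esub> x) = c [^] N \<odot>\<^bsub>M\<^esub> (c \<odot>\<^bsub>M\<^esub> m)"
      using cl f m by (simp add: smult_assoc1 smult_left_commute[of "c [^] N" "f [^] n"])
    then have "stalk_fraction Q x c = stalk_fraction Q m (f [^] n)"
      using cl f m nc pow_notin_colon[OF Q f, of n] pow_notin_colon[OF xc(2) cl(2), of N]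
      by (subst fraction_eq_iff[OF submonoid_colon[OF QS]]) auto
    then show ?thesis using Fs[OF xc] by simp
  qed
  then show thesis using that[OF m] by (auto simp: powers_def)
qed

section \<open>Comparison of sections over \<open>D(fM)\<close> with the localization at
  \<open>f\<close>\<close>

text \<open>From left to right, powers of \<open>f\<close> are allowed denominators at every point
  of \<open>D(fM)\<close>; from right to left, \<open>eq_on_basic_open\<close> is applied to the
  cross products. For the map \<open>h\<close> built below from sections to fractions, the second
  direction gives independence of choices and the first gives injectivity.\<close>

lemma fraction_eq_iff_stalks:
  assumes rad: "P_radical R M" and f: "f \<in> carrier R"
    and mt: "m \<in> carrier M" "t \<in> powers R f" and nu: "n \<in> carrier M" "u \<in> powers R f"
  shows "fraction R M (powers R f) m t = fraction R M (powers R f) n u \<longleftrightarrow>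
    (\<forall>Q \<in> basic_open R M f. stalk_fraction Q m t = stalk_fraction Q n u)"
proof -
  have pc: "v \<in> carrier R - colon R M Q" if "v \<in> powers R f" "Q \<in> basic_open R M f" for v Q
    using that f pow_notin_colon by (auto simp: powers_def)
  have tu: "t \<in> carrier R" "u \<in> carrier R" using mt nu f by (auto simp: powers_def)
  note glob = fraction_eq_iff[OF submonoid_powers[OF f] mt nu]
  have loc: "stalk_fraction Q m t = stalk_fraction Q n u \<longleftrightarrow>
      (\<exists>v \<in> carrier R - colon R M Q. v \<odot>\<^bsub>M\<^esub> (u \<odot>\<^bsub>M\<^esub> m) = v \<odot>\<^bsub>M\<^esub> (t \<odot>\<^bsub>M\<^esub> n))"
    if Q: "Q \<in> basic_open R M f" for Q
    using Q f pc[OF mt(2) Q] pc[OF nu(2) Q] mt(1) nu(1)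
    by (intro fraction_eq_iff submonoid_colon) (simp_all add: in_basic_open)
  show ?thesis
  proof
    assume "fraction R M (powers R f) m t = fraction R M (powers R f) n u"
    then show "\<forall>Q \<in> basic_open R M f. stalk_fraction Q m t = stalk_fraction Q n u"
      using glob loc pc by blast
  next
    assume "\<forall>Q \<in> basic_open R M f. stalk_fraction Q m t = stalk_fraction Q n u"
    then obtain k :: nat where "f [^] k \<odot>\<^bsub>M\<^esub> (u \<odot>\<^bsub>M\<^esub> m) = f [^] k \<odot>\<^bsub>M\<^esub> (t \<odot>\<^bsub>M\<^esub> n)"
      using eq_on_basic_open[OF rad f, of "u \<odot>\<^bsub>M\<^esub> m" "t \<odot>\<^bsub>M\<^esub> n"] loc tu mt(1) nu(1) by blast
    then show "fraction R M (powers R f) m t = fraction R M (powers R f) n u"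
      unfolding glob by (auto simp: powers_def)
  qed
qed

lemma structure_sheaf_basic_open_iso:
  assumes rad: "P_radical R M" and f: "f \<in> carrier R"
  shows "module_isomorphic R (structure_sheaf R M (basic_open R M f)) (localization_away R M f)"
proof -
  let ?D = "basic_open R M f" and ?S = "powers R f"
  let ?O = "structure_sheaf R M ?D" and ?L = "localization_away R M f"
  interpret S: submonoid ?S R by (rule submonoid_powers[OF f])
  interpret O: module R ?O by (rule module_structure_sheaf[OF openin_basic_open[OF f]])
  \<comment> \<open>\<open>h\<close> sends a section to any fraction \<open>m/t\<close> that
    represents it on all of \<open>D(fM)\<close>. Once \<open>h\<close> is independent of the
    representation, linearity follows from the same fraction formulas in the stalks and in the
    localization.\<close>
  define rep where "rep s m t \<longleftrightarrow> m \<in> carrier M \<and> t \<in> ?S \<and> (\<forall>Q \<in> ?D. s Q = stalk_fraction Q m t)" for s m t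
  have car: "carrier ?O = sections R M ?D" by (simp add: structure_sheaf_def)
  have D: "submonoid (carrier R - colon R M Q) R" if "Q \<in> ?D" for Q
    using that f by (simp add: in_basic_open submonoid_colon)
  have SD: "t \<in> carrier R - colon R M Q" if "t \<in> ?S" "Q \<in> ?D" for t Q
    using that f pow_notin_colon by (auto simp: powers_def)
  have "\<exists>z. rep s (fst z) (snd z)" if s: "s \<in> carrier ?O" for s
  proof -
    obtain m t where "m \<in> carrier M" "t \<in> ?S" "\<forall>Q \<in> ?D. s Q = stalk_fraction Q m t"
      by (rule section_eq_fraction[OF rad f s[unfolded car]])
    then show ?thesis by (intro exI[of _ "(m, t)"]) (simp add: rep_def)
  qed
  then have "\<exists>z. \<forall>s \<in> carrier ?O. rep s (fst (z s)) (snd (z s))" by (intro bchoice) blast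
  then obtain z where z: "\<And>s. s \<in> carrier ?O \<Longrightarrow> rep s (fst (z s)) (snd (z s))" by blast
  define h where "h s = fraction R M ?S (fst (z s)) (snd (z s))" for s
  have h: "h s = fraction R M ?S m t" if "s \<in> carrier ?O" "rep s m t" for s m t
    unfolding h_def using that(2) z[OF that(1)] by (subst fraction_eq_iff_stalks[OF rad f]) (auto simp: rep_def)
  have hL: "h s \<in> carrier ?L" if "s \<in> carrier ?O" for s
    using z[OF that] unfolding h_def rep_def by (intro fraction_closed) simp_all
  have ex: "\<exists>m t. rep s m t" if "s \<in> carrier ?O" for s using z[OF that] by blast
  have "h \<in> module_hom R ?O ?L"
    unfolding module_hom_def
  proof (intro CollectI conjI ballI)
    show "h \<in> carrier ?O \<rightarrow> carrier ?L" using hL by (rule Pi_I)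
    fix s assume s: "s \<in> carrier ?O"
    then obtain m t where mt: "rep s m t" using ex by blast
    then have mt': "m \<in> carrier M" "t \<in> ?S" by (auto simp: rep_def)
    show "h (s \<oplus>\<^bsub>?O\<^esub> s') = h s \<oplus>\<^bsub>?L\<^esub> h s'" if s': "s' \<in> carrier ?O" for s'
    proof -
      obtain n u where nu: "rep s' n u" using ex s' by blast
      then have nu': "n \<in> carrier M" "u \<in> ?S" by (auto simp: rep_def)
      have "(s \<oplus>\<^bsub>?O\<^esub> s') Q = stalk_fraction Q (u \<odot>\<^bsub>M\<^esub> m \<oplus>\<^bsub>M\<^esub> t \<odot>\<^bsub>M\<^esub> n) (t \<otimes> u)" if Q: "Q \<in> ?D" for Q
        using mt nu Q add_fraction[OF D[OF Q] mt'(1) nu'(1) SD[OF mt'(2) Q] SD[OF nu'(2) Q]]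
        by (simp add: structure_sheaf_def rep_def)
      then have "rep (s \<oplus>\<^bsub>?O\<^esub> s') (u \<odot>\<^bsub>M\<^esub> m \<oplus>\<^bsub>M\<^esub> t \<odot>\<^bsub>M\<^esub> n) (t \<otimes> u)"
        using mt' nu' S.mem_carrier by (simp add: rep_def)
      then have "h (s \<oplus>\<^bsub>?O\<^esub> s') = fraction R M ?S (u \<odot>\<^bsub>M\<^esub> m \<oplus>\<^bsub>M\<^esub> t \<odot>\<^bsub>M\<^esub> n) (t \<otimes> u)"
        using s s' by (intro h) simp_all
      then show ?thesis
        using h[OF s mt] h[OF s' nu] add_fraction[OF S.submonoid_axioms mt'(1) nu'(1) mt'(2) nu'(2)] by simp
    qed
  next
    fix r s assume r: "r \<in> carrier R" and s: "s \<in> carrier ?O"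
    then obtain m t where mt: "rep s m t" using ex by blast
    then have mt': "m \<in> carrier M" "t \<in> ?S" by (auto simp: rep_def)
    have "(r \<odot>\<^bsub>?O\<^esub> s) Q = stalk_fraction Q (r \<odot>\<^bsub>M\<^esub> m) t" if Q: "Q \<in> ?D" for Q
      using mt Q smult_fraction[OF D[OF Q] r mt'(1) SD[OF mt'(2) Q]]
      by (simp add: structure_sheaf_def rep_def)
    then have "rep (r \<odot>\<^bsub>?O\<^esub> s) (r \<odot>\<^bsub>M\<^esub> m) t" using mt' r by (simp add: rep_def)
    then have "h (r \<odot>\<^bsub>?O\<^esub> s) = fraction R M ?S (r \<odot>\<^bsub>M\<^esub> m) t"
      using r s by (intro h) simp_all
    then show "h (r \<odot>\<^bsub>?O\<^esub> s) = r \<odot>\<^bsub>?L\<^esub> h s"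
      using h[OF s mt] smult_fraction[OF S.submonoid_axioms r mt'] by simp
  qed
  moreover have "bij_betw h (carrier ?O) (carrier ?L)"
  proof (rule bij_betw_imageI)
    show "inj_on h (carrier ?O)"
    proof (rule inj_onI)
      fix s s' assume s: "s \<in> carrier ?O" "s' \<in> carrier ?O" and eq: "h s = h s'"
      note z' = z[OF s(1)] z[OF s(2)]
      have "\<forall>Q \<in> ?D. s Q = s' Q"
        using eq z' fraction_eq_iff_stalks[OF rad f, of "fst (z s)" "snd (z s)" "fst (z s')" "snd (z s')"]
        unfolding h_def rep_def by metis
      then show "s = s'" using s unfolding car by (blast intro: sections_ext)
    qed
    show "h ` carrier ?O = carrier ?L"
    proof
      show "h ` carrier ?O \<subseteq> carrier ?L" using hL by (rule image_subsetI)
      show "carrier ?L \<subseteq> h ` carrier ?O"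
      proof
        fix y assume "y \<in> carrier ?L"
        then obtain m t where y: "m \<in> carrier M" "t \<in> ?S" "y = fraction R M ?S m t"
          by (rule localization_cases)
        \<comment> \<open>The preimage of \<open>m/t\<close> is the section given by this one
          fraction; all of \<open>D(fM)\<close> serves as the neighbourhood of each point.\<close>
        let ?s = "\<lambda>Q \<in> ?D. stalk_fraction Q m t"
        have "?s \<in> sections R M ?D"
        proof (rule sectionsI)
          fix P assume "P \<in> ?D"
          then show "\<exists>W m g. openin (zariski R M) W \<and> P \<in> W \<and> W \<subseteq> ?D \<and> m \<in> carrier M \<and> g \<in> carrier R \<and>
              (\<forall>Q \<in> W. g \<notin> colon R M Q \<and> ?s Q = stalk_fraction Q m g)"
            using openin_basic_open[OF f] y S.mem_carrier SD
            by (intro exI[of _ ?D] exI[of _ m] exI[of _ t]) auto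
        qed simp
        moreover have "rep ?s m t" using y by (simp add: rep_def)
        ultimately have "h ?s = y" using h y(3) car by simp
        then show "y \<in> h ` carrier ?O" using \<open>?s \<in> sections R M ?D\<close> car by blast
      qed
    qed
  qed
  ultimately show ?thesis unfolding module_isomorphic_def by blast
qed

text \<open>The only power of \<open>\<one>\<close> is \<open>\<one>\<close>, so equality of
  fractions reduces to equality of numerators.\<close>

lemma localization_away_one_iso: "module_isomorphic R M (localization_away R M \<one>)"
proof -
  let ?L = "localization_away R M \<one>"
  have S: "powers R \<one> = {\<one>}" by (auto simp: powers_def)
  note sub = submonoid_powers[OF R.one_closed, unfolded S]
  let ?h = "\<lambda>m. fraction R M {\<one>} m \<one>"
  have "?h \<in> module_hom R M ?L"
    unfolding module_hom_def S
    by (auto simp: fraction_closed add_fraction[OF sub] smult_fraction[OF sub])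
  moreover have "inj_on ?h (carrier M)"
    by (rule inj_onI) (simp add: fraction_eq_iff[OF sub])
  moreover have "?h ` carrier M = carrier ?L"
    unfolding S by (auto simp: fraction_closed elim: localization_cases)
  ultimately show ?thesis
    unfolding module_isomorphic_def by (blast intro: bij_betw_imageI)
qed

end

theorem theorem3p2:
  fixes R :: "('r, 'x) ring_scheme" and M :: "('r, 'm, 'y) module_scheme"
  assumes "module R M" and "\<one>\<^bsub>R\<^esub> \<noteq> \<zero>\<^bsub>R\<^esub>" and "P_radical R M"
  shows "(\<forall>f \<in> carrier R.
            module_isomorphic R (structure_sheaf R M (basic_open R M f)) (localization_away R M f)) \<and>
         module_isomorphic R (structure_sheaf R M (Spec R M)) M"
proof -
  interpret module R M by fact
  note iso = structure_sheaf_basic_open_iso[OF assms(3)]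
  \<comment> \<open>This is the case \<open>f = \<one>\<close>, where the basic open set is the
    whole spectrum and the localization is \<open>M\<close> again.\<close>
  have "module_isomorphic R (structure_sheaf R M (Spec R M)) M"
    using iso[OF R.one_closed] module_isomorphic_sym[OF assms(1) localization_away_one_iso]
    unfolding basic_open_one by (rule module_isomorphic_trans)
  with iso show ?thesis by blast
qed

end
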